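(* Let $\mathbf{k}$ be a field of characteristic $p>0$, and let $S = \mathbf{k}[x_{ij}]$ be the polynomial algebra in the entries of the generic $m\times n$ matrix $(x_{ij})$, where $m\geq n\geq 1$. Let $I_n\subset S$ be the ideal generated by the $n\times n$ minors of $(x_{ij})$, and set $R=S/I_n$. Then the diagonal $F$-threshold of $R$ is \[ c(R) = m(n-1).\]
   Context: The generic $m\times n$ matrix has $mn$ independent variables $x_{ij}$ ($1\le i\le m$, $1\le j\le n$) as entries, all of degree $1$. For a standard graded $\mathbf{k}$-algebra $R$ with maximal homogeneous ideal $\mathfrak m$ and $q=p^s$ ($s\ge 0$), the Frobenius power is $\mathfrak m^{[q]}=\langle g^q : g\in\mathfrak m\rangle$, and $v_R(q)=\max\{d\in\mathbb N : \mathfrak m^d\not\subseteq \mathfrak m^{[q]}\}$, equivalently the largest degree in which $R/\mathfrak m^{[q]}$ is non-zero. The diagonal $F$-threshold of $R$ is $c(R)=\lim_{q\to\infty} v_R(q)/q$, where $q=p^s$ with $s\to\infty$ (this limit is known to exist). *)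

theory Defs
  imports
    "HOL-Analysis.Determinants"
    "HOL-Library.Poly_Mapping"
    "HOL-Algebra.Ideal_Product"
    "HOL-Algebra.QuotRing"
    "HOL-Algebra.Algebraic_Closure_Type"
begin

section \<open>Diagonal F-thresholds\<close>

definition frobenius_power :: "('a, 'b) ring_scheme \<Rightarrow> 'a set \<Rightarrow> nat \<Rightarrow> 'a set"
  where "frobenius_power R M q = genideal R {g [^]\<^bsub>R\<^esub> q | g. g \<in> M}"

text \<open>
  The ideal power \<open>M\<^sup>d\<close> is the power in the multiplicative monoid \<^const>\<open>ideals_set\<close> of
  ideals of \<open>R\<close>; in particular \<open>M\<^sup>0\<close> is the unit ideal. For a standard graded algebra \<open>R\<close>,
  the argument \<open>M\<close> is meant to be its maximal homogeneous ideal; the set below is then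
  finite when \<open>q > 0\<close>, and it contains 0.
\<close>

definition frobenius_top_degree :: "('a, 'b) ring_scheme \<Rightarrow> 'a set \<Rightarrow> nat \<Rightarrow> nat"
  where "frobenius_top_degree R M q =
    Max {d. \<not> M [^]\<^bsub>ideals_set R\<^esub> d \<subseteq> frobenius_power R M q}"

definition F_threshold_seq :: "nat \<Rightarrow> ('a, 'b) ring_scheme \<Rightarrow> 'a set \<Rightarrow> nat \<Rightarrow> real"
  where "F_threshold_seq p R M s = real (frobenius_top_degree R M (p ^ s)) / real (p ^ s)"

definition diagonal_F_threshold :: "nat \<Rightarrow> ('a, 'b) ring_scheme \<Rightarrow> 'a set \<Rightarrow> real"
  where "diagonal_F_threshold p R M = lim (F_threshold_seq p R M)"


section \<open>The generic determinantal ring of maximal minors\<close>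

text \<open>
  Polynomials over \<open>'k\<close> in variables indexed by \<open>'m \<times> 'n\<close>: finitely supported maps from
  exponent vectors to coefficients, with convolution product.
\<close>

type_synonym ('m, 'n, 'k) matrix_poly = "(('m \<times> 'n) \<Rightarrow>\<^sub>0 nat) \<Rightarrow>\<^sub>0 'k"

definition generic_matrix :: "('m::finite, 'n::finite, 'k::field) matrix_poly ^ 'n ^ 'm"
  where "generic_matrix =
    (\<chi> i j. Poly_Mapping.single (Poly_Mapping.single (i, j) 1) 1)"

text \<open>
  An \<open>n \<times> n\<close> minor is given by a choice of \<open>n\<close> distinct rows. As the index types carry no
  order, a choice of rows is listed by an arbitrary injection, so both signs of every minor
  may occur.
\<close>

definition maximal_minors :: "('m::finite, 'n::finite, 'k::field) matrix_poly set"
  where "maximal_minors = {det (\<chi> i. generic_matrix $ r i) | r :: 'n \<Rightarrow> 'm. inj r}"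

abbreviation matrix_poly_ring :: "('m::finite, 'n::finite, 'k::field) matrix_poly ring"
  where "matrix_poly_ring \<equiv> ring_of_type_algebra"

definition determinantal_ideal :: "('m::finite, 'n::finite, 'k::field) matrix_poly set"
  where "determinantal_ideal = genideal matrix_poly_ring maximal_minors"

definition determinantal_ring :: "('m::finite, 'n::finite, 'k::field) matrix_poly set ring"
  where "determinantal_ring = matrix_poly_ring Quot determinantal_ideal"

text \<open>
  All variables have degree 1, so the positive-degree part of the quotient is the image of
  the polynomials with vanishing constant term.
\<close>

definition determinantal_max_ideal :: "('m::finite, 'n::finite, 'k::field) matrix_poly set set"
  where "determinantal_max_ideal =
    (\<lambda>f. determinantal_ideal +>\<^bsub>matrix_poly_ring\<^esub> f) ` {f. Poly_Mapping.lookup f 0 = 0}"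

end

theory Submission
  imports Defs
begin

text \<open>
  For \<open>q = p\<^sup>s\<close> the largest degree in which \<open>R/\<mm>\<^bsup>[q]\<^esup>\<close> is non-zero is exactly \<open>m(n - 1)(q - 1)\<close>.

  Lower bound: the monomial with exponent 0 in one column and \<open>q - 1\<close> elsewhere is not in the
  monomial ideal generated by all \<open>q\<close>-th powers and the variables of that column, and this ideal
  contains the maximal minors.

  Upper bound, by induction on \<open>n\<close>: a monomial of larger degree with all exponents below \<open>q\<close> has
  degree greater than \<open>(n - 1)(q - 1)\<close> in some row \<open>i\<close>; let \<open>b\<close> be a column of least degree. If all
  exponents in row \<open>i\<close> outside column \<open>b\<close> are \<open>q - 1\<close>, then multiplying by them kills, modulo \<open>q\<close>-th
  powers, all terms of the expansion of a minor along row \<open>i\<close> except \<open>x\<^sub>i\<^sub>b\<close> times an \<open>(n - 1)\<close>-minor,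
  and the degree left outside row \<open>i\<close> and column \<open>b\<close> is large enough for the induction
  hypothesis (this uses \<open>m \<ge> n\<close>). Other exponents are reduced to this case by the column operations
  that add \<open>t\<close> times column \<open>b\<close> to another column. They preserve the ideal of minors and \<open>q\<close>-th
  powers, and the coefficients \<open>(q - 1) choose k\<close> that they produce are \<open>\<plusminus>1\<close> modulo \<open>p\<close>.
\<close>

section \<open>Polynomials and substitutions\<close>

definition monomial_value :: "('v::finite \<Rightarrow> 'b::comm_ring_1) \<Rightarrow> ('v \<Rightarrow>\<^sub>0 nat) \<Rightarrow> 'b"
  where "monomial_value y \<alpha> = (\<Prod>v\<in>UNIV. y v ^ Poly_Mapping.lookup \<alpha> v)"

text \<open>Coefficients and variables are mapped separately because the column operations below
  take values in another ring, the polynomials in an extra parameter.\<close>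

definition eval_poly_mapping ::
  "('k::comm_ring_1 \<Rightarrow> 'b::comm_ring_1) \<Rightarrow> ('v::finite \<Rightarrow> 'b) \<Rightarrow> (('v \<Rightarrow>\<^sub>0 nat) \<Rightarrow>\<^sub>0 'k) \<Rightarrow> 'b"
  where "eval_poly_mapping h y f = (\<Sum>\<alpha>\<in>Poly_Mapping.keys f. h (Poly_Mapping.lookup f \<alpha>) * monomial_value y \<alpha>)"

lemma monomial_value_add: "monomial_value y (\<alpha> + \<beta>) = monomial_value y \<alpha> * monomial_value y \<beta>"
  by (simp add: monomial_value_def lookup_add power_add prod.distrib)

lemma monomial_value_0: "monomial_value y 0 = 1"
  by (simp add: monomial_value_def)

lemma monomial_value_single: "monomial_value y (Poly_Mapping.single v n) = y v ^ n"
proof -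
  have "monomial_value y (Poly_Mapping.single v n) = (\<Prod>w\<in>UNIV. if w = v then y v ^ n else 1)"
    unfolding monomial_value_def by (rule prod.cong) (auto simp: lookup_single when_def)
  then show ?thesis by simp
qed

lemma poly_mapping_sum_single:
  "f = (\<Sum>\<alpha>\<in>Poly_Mapping.keys f. Poly_Mapping.single \<alpha> (Poly_Mapping.lookup f \<alpha>))"
  by (rule poly_mapping_eqI)
    (auto simp: lookup_sum lookup_single when_def in_keys_iff sum.delta)

text \<open>Ring homomorphisms between type-class rings. Compatibility with sums, products and signs
  yields compatibility with minors for every substitution at once.\<close>

locale unital_hom =
  fixes h :: "'k::comm_ring_1 \<Rightarrow> 'b::comm_ring_1"
  assumes hom_add: "h (a + b) = h a + h b"
    and hom_mult: "h (a * b) = h a * h b"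
    and hom_1: "h 1 = 1"
begin

lemma hom_0: "h 0 = 0"
  using hom_add[of 0 0] by simp

lemma hom_uminus: "h (- a) = - h a"
  using hom_add[of a "- a"] by (simp add: hom_0 add_eq_0_iff)

lemma hom_sum: "h (\<Sum>i\<in>I. f i) = (\<Sum>i\<in>I. h (f i))"
  by (induction I rule: infinite_finite_induct) (simp_all add: hom_0 hom_add)

lemma hom_prod: "h (\<Prod>i\<in>I. f i) = (\<Prod>i\<in>I. h (f i))"
  by (induction I rule: infinite_finite_induct) (simp_all add: hom_1 hom_mult)

lemma hom_power: "h (a ^ n) = h a ^ n"
  by (induction n) (simp_all add: hom_1 hom_mult)

lemma hom_sign: "h (of_int (sign \<pi>)) = of_int (sign \<pi>)"
  by (simp add: sign_def hom_1 hom_uminus)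

lemma eval_superset:
  assumes "finite A" "Poly_Mapping.keys f \<subseteq> A"
  shows "eval_poly_mapping h y f = (\<Sum>\<alpha>\<in>A. h (Poly_Mapping.lookup f \<alpha>) * monomial_value y \<alpha>)"
  unfolding eval_poly_mapping_def
  by (rule sum.mono_neutral_left) (use assms in \<open>auto simp: in_keys_iff hom_0\<close>)

lemma eval_add: "eval_poly_mapping h y (f + g) = eval_poly_mapping h y f + eval_poly_mapping h y g"
proof -
  have "Poly_Mapping.keys (f + g) \<subseteq> Poly_Mapping.keys f \<union> Poly_Mapping.keys g" by (rule keys_add)
  then show ?thesis
    by (simp add: eval_superset[of "Poly_Mapping.keys f \<union> Poly_Mapping.keys g"] lookup_add hom_add
        distrib_right sum.distrib)
qed

lemma eval_0: "eval_poly_mapping h y 0 = 0"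
  by (simp add: eval_poly_mapping_def)

lemma eval_sum: "eval_poly_mapping h y (\<Sum>i\<in>I. f i) = (\<Sum>i\<in>I. eval_poly_mapping h y (f i))"
  by (induction I rule: infinite_finite_induct) (simp_all add: eval_0 eval_add)

lemma eval_single:
  "eval_poly_mapping h y (Poly_Mapping.single \<alpha> c) = h c * monomial_value y \<alpha>"
  by (simp add: eval_superset[of "{\<alpha>}"])

lemma eval_mult:
  "eval_poly_mapping h y (f * g) = eval_poly_mapping h y f * eval_poly_mapping h y g"
proof -
  have "f * g = (\<Sum>\<alpha>\<in>Poly_Mapping.keys f. \<Sum>\<beta>\<in>Poly_Mapping.keys g.
      Poly_Mapping.single (\<alpha> + \<beta>) (Poly_Mapping.lookup f \<alpha> * Poly_Mapping.lookup g \<beta>))"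
    by (subst poly_mapping_sum_single[of f], subst poly_mapping_sum_single[of g])
      (simp add: sum_product mult_single)
  then have "eval_poly_mapping h y (f * g) =
      (\<Sum>\<alpha>\<in>Poly_Mapping.keys f. \<Sum>\<beta>\<in>Poly_Mapping.keys g.
        (h (Poly_Mapping.lookup f \<alpha>) * monomial_value y \<alpha>) *
        (h (Poly_Mapping.lookup g \<beta>) * monomial_value y \<beta>))"
    by (simp only: eval_sum eval_single hom_mult monomial_value_add mult_ac)
  then show ?thesis
    by (simp only: eval_poly_mapping_def sum_product)
qed

lemma unital_hom_eval: "unital_hom (eval_poly_mapping h y)"
proof
  show "eval_poly_mapping h y 1 = 1"
    using eval_single[of y 0 1] by (simp add: hom_1 monomial_value_0)
qed (fact eval_add eval_mult)+

end

section \<open>Monomials and variables as polynomials\<close>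

abbreviation mon :: "('v \<Rightarrow>\<^sub>0 nat) \<Rightarrow> ('v \<Rightarrow>\<^sub>0 nat) \<Rightarrow>\<^sub>0 'k::comm_ring_1"
  where "mon \<alpha> \<equiv> Poly_Mapping.single \<alpha> 1"

definition var :: "'v \<Rightarrow> ('v \<Rightarrow>\<^sub>0 nat) \<Rightarrow>\<^sub>0 'k::comm_ring_1"
  where "var v = mon (Poly_Mapping.single v 1)"

lemma mon_add: "mon (\<alpha> + \<beta>) = mon \<alpha> * mon \<beta>"
  by (simp add: mult_single)

lemma var_power: "var v ^ n = mon (Poly_Mapping.single v n)"
  by (induction n) (simp_all add: var_def mult_single flip: single_add)

lemma mon_eq_prod:
  fixes \<alpha> :: "'v::finite \<Rightarrow>\<^sub>0 nat"
  shows "(mon \<alpha> :: _ \<Rightarrow>\<^sub>0 'k::comm_ring_1) = (\<Prod>v\<in>UNIV. var v ^ Poly_Mapping.lookup \<alpha> v)"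
proof -
  have *: "(mon (\<Sum>v\<in>A. Poly_Mapping.single v (Poly_Mapping.lookup \<alpha> v)) :: _ \<Rightarrow>\<^sub>0 'k) =
      (\<Prod>v\<in>A. var v ^ Poly_Mapping.lookup \<alpha> v)" for A
    by (induction A rule: infinite_finite_induct) (simp_all add: mon_add var_power)
  have "\<alpha> = (\<Sum>v\<in>UNIV. Poly_Mapping.single v (Poly_Mapping.lookup \<alpha> v))"
    by (rule poly_mapping_eqI) (simp add: lookup_sum lookup_single when_def)
  with *[of UNIV] show ?thesis by simp
qed

text \<open>A commutative ring is a module over itself and its submodules are its ideals:
  \<open>ideal_span.subspace\<close> means ideal, and \<open>ideal_span.span\<close> gives the ideal
  generated by a set.\<close>

global_interpretation ideal_span: Modules.module "(*) :: 'a::comm_ring_1 \<Rightarrow> 'a \<Rightarrow> 'a"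
  by unfold_locales (simp_all add: algebra_simps)
\<comment> \<open>As a simp rule, this re-associates products against \<open>mult_ac\<close>, and the simplifier loops.\<close>
declare ideal_span.scale_scale [simp del]

section \<open>Minors\<close>

text \<open>The determinant with column set \<open>B\<close> whose row at position \<open>j\<close>
  is \<open>\<rho> j\<close>. Subsets of fixed index types, unlike \<open>det\<close> over a whole
  type, let the induction delete a row and a column.\<close>

definition minor_on :: "('i \<Rightarrow> 'n \<Rightarrow> 'a::comm_ring_1) \<Rightarrow> ('n \<Rightarrow> 'i) \<Rightarrow> 'n set \<Rightarrow> 'a"
  where "minor_on y \<rho> B = (\<Sum>\<pi> | \<pi> permutes B. of_int (sign \<pi>) * (\<Prod>j\<in>B. y (\<rho> j) (\<pi> j)))"

text \<open>Laplace expansion along row \<open>\<rho> b\<close> modulo \<open>J\<close>.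
  Permutations of \<open>B\<close> fixing \<open>b\<close> are those of \<open>B - {b}\<close>, with
  the same sign; any other picks an entry of this row outside column \<open>b\<close>, which
  \<open>w\<close> sends into \<open>J\<close>.\<close>

lemma minor_on_expand:
  assumes "finite B" "b \<in> B" "ideal_span.subspace J"
    and "\<And>j. j \<in> B - {b} \<Longrightarrow> w * y (\<rho> b) j \<in> J"
  shows "w * minor_on y \<rho> B - w * y (\<rho> b) b * minor_on y \<rho> (B - {b}) \<in> J"
proof -
  let ?f = "\<lambda>\<pi>. of_int (sign \<pi>) * (\<Prod>j\<in>B. y (\<rho> j) (\<pi> j))"
  let ?P = "{\<pi>. \<pi> permutes B}" and ?Q = "{\<pi>. \<pi> permutes (B - {b})}"
  have finite: "finite ?P"
    using assms(1) by (rule finite_permutations)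
  have sub: "?Q \<subseteq> ?P"
    by (auto intro: permutes_subset)
  have split: "minor_on y \<rho> B = sum ?f ?Q + sum ?f (?P - ?Q)"
    unfolding minor_on_def using sum.subset_diff[OF sub finite, of ?f] by (simp add: add.commute)
  have fixed: "sum ?f ?Q = y (\<rho> b) b * minor_on y \<rho> (B - {b})"
  proof -
    have "?f \<pi> = y (\<rho> b) b * (of_int (sign \<pi>) * (\<Prod>j\<in>B - {b}. y (\<rho> j) (\<pi> j)))" if "\<pi> \<in> ?Q" for \<pi>
    proof -
      have "\<pi> b = b" using that by (auto simp: permutes_def)
      then have "(\<Prod>j\<in>B. y (\<rho> j) (\<pi> j)) = y (\<rho> b) b * (\<Prod>j\<in>B - {b}. y (\<rho> j) (\<pi> j))"
        using prod.remove[OF assms(1,2), of "\<lambda>j. y (\<rho> j) (\<pi> j)"] by simp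
      then show ?thesis
        by (simp only: mult_ac)
    qed
    then show ?thesis
      by (simp add: minor_on_def sum_distrib_left)
  qed
  have "w * sum ?f (?P - ?Q) \<in> J"
  proof -
    have "w * ?f \<pi> \<in> J" if "\<pi> \<in> ?P - ?Q" for \<pi>
    proof -
      have "\<pi> permutes B" using that by simp
      moreover have "\<pi> b \<noteq> b"
      proof
        assume "\<pi> b = b"
        with \<open>\<pi> permutes B\<close> have "\<pi> permutes (B - {b})"
          by (auto simp: permutes_def)
        with that show False by simp
      qed
      ultimately have "w * y (\<rho> b) (\<pi> b) \<in> J"
        using assms(2,4) by (metis DiffI permutes_in_image singletonD)
      then have "of_int (sign \<pi>) * (\<Prod>j\<in>B - {b}. y (\<rho> j) (\<pi> j)) * (w * y (\<rho> b) (\<pi> b)) \<in> J"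
        by (rule ideal_span.subspace_scale[OF assms(3)])
      moreover have "(\<Prod>j\<in>B. y (\<rho> j) (\<pi> j)) = y (\<rho> b) (\<pi> b) * (\<Prod>j\<in>B - {b}. y (\<rho> j) (\<pi> j))"
        by (rule prod.remove[OF assms(1,2)])
      ultimately show ?thesis
        by (simp only: mult_ac)
    qed
    then show ?thesis
      unfolding sum_distrib_left by (intro ideal_span.subspace_sum[OF assms(3)]) auto
  qed
  moreover have "w * minor_on y \<rho> B - w * y (\<rho> b) b * minor_on y \<rho> (B - {b}) = w * sum ?f (?P - ?Q)"
    unfolding split fixed distrib_left mult.assoc by (rule add_diff_cancel_left')
  ultimately show ?thesis by (simp only:)
qed

text \<open>Composition with the transposition of \<open>j\<close> and \<open>b\<close> matches odd
  permutations with even ones, and matched terms cancel. Unlike deriving that the minor equals its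
  negative, this works in characteristic 2 as well.\<close>

lemma minor_on_repeated_column:
  assumes "finite B" "j \<in> B" "b \<in> B" "j \<noteq> b" "\<And>i. y i j = y i b"
  shows "minor_on y \<rho> B = 0"
proof -
  let ?f = "\<lambda>\<pi>. of_int (sign \<pi>) * (\<Prod>l\<in>B. y (\<rho> l) (\<pi> l))"
  let ?P = "{\<pi>. \<pi> permutes B}" and ?E = "{\<pi>. \<pi> permutes B \<and> evenperm \<pi>}"
  let ?t = "\<lambda>\<pi>. Transposition.transpose j b \<circ> \<pi>"
  have finite: "finite ?P"
    using assms(1) by (rule finite_permutations)
  have t: "Transposition.transpose j b permutes B"
    using assms by (intro permutes_swap_id) auto
  have perm: "permutation \<pi>" if "\<pi> permutes B" for \<pi>
    using that assms(1) permutation_permutes by blast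
  have sign_t: "sign (?t \<pi>) = - sign \<pi>" if "\<pi> permutes B" for \<pi>
    using perm[OF that] perm[OF t] assms(4) by (simp add: sign_compose sign_swap_id)
  have y_t: "y i (Transposition.transpose j b l) = y i l" for i l
    using assms(5) by (auto simp: Transposition.transpose_def)
  have "sum ?f (?P - ?E) = (\<Sum>\<pi>\<in>?E. - ?f \<pi>)"
  proof (rule sum.reindex_bij_witness[where i = ?t and j = ?t])
    fix \<pi> assume \<pi>: "\<pi> \<in> ?P - ?E"
    show "?t (?t \<pi>) = \<pi>" by (simp add: fun_eq_iff)
    show "?t \<pi> \<in> ?E"
      using \<pi> t sign_t[of \<pi>] by (auto simp: permutes_compose sign_def split: if_splits)
    show "- ?f (?t \<pi>) = ?f \<pi>"
      using \<pi> sign_t[of \<pi>] by (simp add: y_t)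
  next
    fix \<pi> assume \<pi>: "\<pi> \<in> ?E"
    show "?t (?t \<pi>) = \<pi>" by (simp add: fun_eq_iff)
    show "?t \<pi> \<in> ?P - ?E"
      using \<pi> t sign_t[of \<pi>] by (auto simp: permutes_compose sign_def split: if_splits)
  qed
  then have "sum ?f (?P - ?E) = - sum ?f ?E"
    by (simp add: sum_negf)
  moreover have "minor_on y \<rho> B = sum ?f (?P - ?E) + sum ?f ?E"
    unfolding minor_on_def by (rule sum.subset_diff) (use finite in auto)
  ultimately show ?thesis by simp
qed

text \<open>The minor is linear in column \<open>j\<close>, and the summand multiplied by
  \<open>t\<close> has equal columns \<open>j\<close> and \<open>b\<close>.\<close>

lemma minor_on_add_column:
  fixes y :: "'a \<Rightarrow> 'b \<Rightarrow> 'c::comm_ring_1"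
  assumes "finite B" "j \<in> B" "b \<in> B" "j \<noteq> b"
  shows "minor_on (\<lambda>i l. if l = j then y i j + t * y i b else y i l) \<rho> B = minor_on y \<rho> B"
proof -
  let ?z = "\<lambda>i l. if l = j then y i b else y i l"
  have "(\<Prod>l\<in>B. if \<pi> l = j then y (\<rho> l) j + t * y (\<rho> l) b else y (\<rho> l) (\<pi> l)) =
      (\<Prod>l\<in>B. y (\<rho> l) (\<pi> l)) + t * (\<Prod>l\<in>B. ?z (\<rho> l) (\<pi> l))" if "\<pi> permutes B" for \<pi>
  proof -
    have inj: "inj \<pi>" and "j \<in> \<pi> ` B"
      using permutes_inj[OF that] permutes_image[OF that] assms(2) by simp_all
    \<comment> \<open>\<open>c\<close> is the only index that \<open>\<pi>\<close> sends to
      \<open>j\<close>, so exactly one factor of the product changes.\<close>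
    then obtain c where c: "c \<in> B" "\<pi> c = j"
      by auto
    have other: "\<pi> l \<noteq> j" if "l \<in> B - {c}" for l
    proof
      assume "\<pi> l = j"
      then have "l = c" using injD[OF inj, of l c] c(2) by simp
      with that show False by simp
    qed
    have rest: "(\<Prod>l\<in>B - {c}. if \<pi> l = j then u l else v l) = (\<Prod>l\<in>B - {c}. v l)"
      for u v :: "'b \<Rightarrow> 'c"
      by (rule prod.cong[OF refl]) (simp only: other if_False)
    have split: "(\<Prod>l\<in>B. if \<pi> l = j then u l else y (\<rho> l) (\<pi> l)) =
        u c * (\<Prod>l\<in>B - {c}. y (\<rho> l) (\<pi> l))" for u
      by (subst prod.remove[OF assms(1) c(1)]) (simp only: rest c refl if_True)
    have "(\<Prod>l\<in>B. y (\<rho> l) (\<pi> l)) = y (\<rho> c) j * (\<Prod>l\<in>B - {c}. y (\<rho> l) (\<pi> l))"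
      by (subst prod.remove[OF assms(1) c(1)]) (simp only: c)
    then show ?thesis
      by (simp only: split distrib_right mult.assoc)
  qed
  then have "minor_on (\<lambda>i l. if l = j then y i j + t * y i b else y i l) \<rho> B =
      (\<Sum>\<pi> | \<pi> permutes B. of_int (sign \<pi>) * (\<Prod>l\<in>B. y (\<rho> l) (\<pi> l)) +
        t * (of_int (sign \<pi>) * (\<Prod>l\<in>B. ?z (\<rho> l) (\<pi> l))))"
    unfolding minor_on_def
    by (intro sum.cong refl) (simp only: mem_Collect_eq distrib_left mult.left_commute)
  also have "\<dots> = minor_on y \<rho> B + t * minor_on ?z \<rho> B"
    by (simp only: minor_on_def sum.distrib sum_distrib_left)
  also have "minor_on ?z \<rho> B = 0"
    using assms by (intro minor_on_repeated_column[of B j b]) auto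
  finally show ?thesis by simp
qed

lemma (in unital_hom) hom_minor_on:
  "h (minor_on y \<rho> B) = minor_on (\<lambda>i j. h (y i j)) \<rho> B"
  by (simp add: minor_on_def hom_sum hom_mult hom_sign hom_prod)

section \<open>The filtration by degree in a set of variables\<close>

definition degree_on :: "'v set \<Rightarrow> ('v \<Rightarrow>\<^sub>0 nat) \<Rightarrow> nat"
  where "degree_on D \<alpha> = (\<Sum>v\<in>D. Poly_Mapping.lookup \<alpha> v)"

text \<open>For finite \<open>D\<close> this is the \<open>d\<close>-th power of the ideal generated
  by the variables in \<open>D\<close>.\<close>

definition order_ge :: "'v set \<Rightarrow> nat \<Rightarrow> (('v \<Rightarrow>\<^sub>0 nat) \<Rightarrow>\<^sub>0 'k::comm_ring_1) set"
  where "order_ge D d = {f. \<forall>\<alpha>\<in>Poly_Mapping.keys f. d \<le> degree_on D \<alpha>}"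

lemma degree_on_add: "degree_on D (\<alpha> + \<beta>) = degree_on D \<alpha> + degree_on D \<beta>"
  by (simp add: degree_on_def lookup_add sum.distrib)

lemma order_ge_mult:
  assumes "f \<in> order_ge D d" "g \<in> order_ge D e"
  shows "f * g \<in> order_ge D (d + e)"
  unfolding order_ge_def
proof (intro CollectI ballI)
  fix \<alpha> assume "\<alpha> \<in> Poly_Mapping.keys (f * g)"
  then obtain a b where "a \<in> Poly_Mapping.keys f" "b \<in> Poly_Mapping.keys g" "\<alpha> = a + b"
    using keys_mult[of f g] by blast
  with assms show "d + e \<le> degree_on D \<alpha>"
    by (auto simp: order_ge_def degree_on_add intro: add_mono)
qed

lemma order_ge_mono: "d \<le> e \<Longrightarrow> order_ge D e \<subseteq> order_ge D d"
  by (auto simp: order_ge_def)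

lemma order_ge_0: "order_ge D 0 = UNIV"
  by (auto simp: order_ge_def)

lemma subspace_order_ge: "ideal_span.subspace (order_ge D d)"
proof (rule ideal_span.subspaceI)
  show "0 \<in> order_ge D d" by (simp add: order_ge_def)
  show "f + g \<in> order_ge D d" if "f \<in> order_ge D d" "g \<in> order_ge D d" for f g
    using that keys_add[of f g] by (auto simp: order_ge_def)
  show "c * f \<in> order_ge D d" if "f \<in> order_ge D d" for c f
    using order_ge_mult[of c D 0 f d] that by (simp add: order_ge_0)
qed

lemma mon_in_order_ge: "mon \<alpha> \<in> order_ge D (degree_on D \<alpha>)"
  by (simp add: order_ge_def)

lemma var_in_order_ge: "var v \<in> order_ge D (if v \<in> D then 1 else 0)"
  if "finite D"
proof (cases "v \<in> D")
  case True
  then have "degree_on D (Poly_Mapping.single v 1) = 1"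
    using that by (simp add: degree_on_def lookup_single when_def sum.remove[of D v])
  then show ?thesis
    using True mon_in_order_ge[of "Poly_Mapping.single v 1" D] by (simp add: var_def)
qed (simp add: order_ge_0)

lemma order_ge_subset_ideal:
  assumes "ideal_span.subspace J" "\<And>\<alpha>. d \<le> degree_on D \<alpha> \<Longrightarrow> mon \<alpha> \<in> J"
  shows "order_ge D d \<subseteq> J"
proof
  fix f :: "('a \<Rightarrow>\<^sub>0 nat) \<Rightarrow>\<^sub>0 'b" assume f: "f \<in> order_ge D d"
  have "(\<Sum>\<alpha>\<in>Poly_Mapping.keys f. Poly_Mapping.single \<alpha> (Poly_Mapping.lookup f \<alpha>)) \<in> J"
  proof (rule ideal_span.subspace_sum[OF assms(1)])
    fix \<alpha> assume "\<alpha> \<in> Poly_Mapping.keys f"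
    with f assms(2) have "mon \<alpha> \<in> J" by (simp add: order_ge_def)
    then have "Poly_Mapping.single 0 (Poly_Mapping.lookup f \<alpha>) * mon \<alpha> \<in> J"
      by (rule ideal_span.subspace_scale[OF assms(1)])
    then show "Poly_Mapping.single \<alpha> (Poly_Mapping.lookup f \<alpha>) \<in> J"
      by (simp add: mult_single)
  qed
  then show "f \<in> J"
    by (simp flip: poly_mapping_sum_single)
qed

text \<open>This is the colon ideal of \<open>J\<close> by \<open>w\<close>. Being an ideal, it
  reduces membership of products \<open>w * f\<close> to generators or monomials.\<close>

lemma subspace_colon:
  assumes "ideal_span.subspace J"
  shows "ideal_span.subspace {f. w * f \<in> J}"
proof (rule ideal_span.subspaceI)
  show "c * f \<in> {f. w * f \<in> J}" if "f \<in> {f. w * f \<in> J}" for c f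
    using ideal_span.subspace_scale[OF assms, of "w * f" c] that by (simp add: mult.left_commute)
qed (use assms in \<open>auto simp: distrib_left ideal_span.subspace_0 ideal_span.subspace_add\<close>)

lemma mon_split:
  assumes "\<And>v. Poly_Mapping.lookup \<alpha> v \<le> Poly_Mapping.lookup \<beta> v"
  shows "mon \<beta> = mon \<alpha> * mon (\<beta> - \<alpha>)"
proof -
  have "\<beta> = \<alpha> + (\<beta> - \<alpha>)"
    using assms by (intro poly_mapping_eqI) (simp add: lookup_add lookup_minus)
  then show ?thesis by (metis mon_add)
qed

lemma mon_mem_if_power_mem:
  assumes "ideal_span.subspace J" "var v ^ q \<in> J" "q \<le> Poly_Mapping.lookup \<beta> v"
  shows "mon \<beta> \<in> J"
proof -
  have "mon \<beta> = mon (Poly_Mapping.single v q) * mon (\<beta> - Poly_Mapping.single v q)"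
    using assms(3) by (intro mon_split) (auto simp: lookup_single when_def)
  then have "mon \<beta> = mon (\<beta> - Poly_Mapping.single v q) * var v ^ q"
    by (simp only: var_power mult.commute)
  then show ?thesis
    using ideal_span.subspace_scale[OF assms(1,2)] by metis
qed

section \<open>Binomial coefficients modulo a prime\<close>

text \<open>With \<open>q = p ^ s\<close>, the identity
  \<open>i * (q choose i) = q * (q - 1 choose (i - 1))\<close> would give \<open>q dvd i\<close> if
  \<open>p\<close> did not divide the binomial coefficient.\<close>

lemma prime_dvd_choose_prime_power:
  assumes "prime (p::nat)" "0 < i" "i < p ^ s"
  shows "p dvd (p ^ s choose i)"
proof (rule ccontr)
  assume "\<not> p dvd (p ^ s choose i)"
  then have "coprime (p ^ s) (p ^ s choose i)"
    using assms(1) by (simp add: prime_imp_coprime)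
  moreover have "p ^ s dvd i * (p ^ s choose i)"
    using times_binomial_minus1_eq[of i "p ^ s"] assms(2) by simp
  ultimately have "p ^ s dvd i"
    by (simp add: coprime_dvd_mult_left_iff)
  with assms(2,3) show False
    by (auto dest: dvd_imp_le)
qed

text \<open>Pascal's rule writes \<open>p ^ s choose Suc i\<close>, which vanishes, as the sum of
  two neighbours, so the signs alternate. These coefficients are therefore units.\<close>

lemma choose_prime_power_minus_1:
  assumes "prime p" "of_nat p = (0 :: 'a::comm_ring_1)" "i \<le> p ^ s - 1"
  shows "of_nat (p ^ s - 1 choose i) = ((-1) ^ i :: 'a)"
  using assms(3)
proof (induction i)
  case (Suc i)
  have "0 < p ^ s" using assms(1) by (simp add: prime_gt_0_nat)
  then have "Suc i < p ^ s" using Suc.prems by linarith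
  then have "of_nat (p ^ s choose Suc i) = (0 :: 'a)"
    using prime_dvd_choose_prime_power[OF assms(1), of "Suc i" s] assms(2)
    by (auto elim!: dvdE)
  moreover have "p ^ s choose Suc i = (p ^ s - 1 choose i) + (p ^ s - 1 choose Suc i)"
    using assms(1) by (metis Suc_diff_1 binomial_Suc_Suc prime_gt_0_nat zero_less_power)
  ultimately show ?case
    using Suc by (simp add: add_eq_0_iff)
qed simp

section \<open>The ideal of minors and powers of the variables\<close>

text \<open>The powers of all variables are included, not only of those in
  \<open>A \<times> B\<close>, so that shrinking \<open>A\<close> and \<open>B\<close> affects the
  minors alone.\<close>

definition minor_gens ::
  "nat \<Rightarrow> 'm set \<Rightarrow> 'n set \<Rightarrow> (('m \<times> 'n \<Rightarrow>\<^sub>0 nat) \<Rightarrow>\<^sub>0 'k::comm_ring_1) set"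
  where "minor_gens q A B =
    range (\<lambda>v. var v ^ q) \<union> {minor_on (\<lambda>i j. var (i, j)) \<rho> B | \<rho>. inj_on \<rho> B \<and> \<rho> ` B \<subseteq> A}"

definition minor_ideal ::
  "nat \<Rightarrow> 'm set \<Rightarrow> 'n set \<Rightarrow> (('m \<times> 'n \<Rightarrow>\<^sub>0 nat) \<Rightarrow>\<^sub>0 'k::comm_ring_1) set"
  where "minor_ideal q A B = ideal_span.span (minor_gens q A B)"

lemma subspace_minor_ideal: "ideal_span.subspace (minor_ideal q A B)"
  by (simp add: minor_ideal_def)

lemmas minor_ideal_scale = ideal_span.subspace_scale[OF subspace_minor_ideal]

lemma var_power_in_minor_ideal: "var v ^ q \<in> minor_ideal q A B"
  unfolding minor_ideal_def minor_gens_def by (rule ideal_span.span_base) auto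

lemma minor_in_minor_ideal:
  "inj_on \<rho> B \<Longrightarrow> \<rho> ` B \<subseteq> A \<Longrightarrow> minor_on (\<lambda>i j. var (i, j)) \<rho> B \<in> minor_ideal q A B"
  unfolding minor_ideal_def minor_gens_def by (rule ideal_span.span_base) auto

lemma minor_ideal_subset:
  assumes "ideal_span.subspace J" "\<And>v. var v ^ q \<in> J"
    and "\<And>\<rho>. inj_on \<rho> B \<Longrightarrow> \<rho> ` B \<subseteq> A \<Longrightarrow> minor_on (\<lambda>i j. var (i, j)) \<rho> B \<in> J"
  shows "minor_ideal q A B \<subseteq> J"
  unfolding minor_ideal_def
  by (rule ideal_span.span_minimal) (use assms in \<open>auto simp: minor_gens_def\<close>)

section \<open>The column operation with a parameter\<close>

text \<open>The indeterminate of the outer \<open>poly\<close> is the parameter t: column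
  \<open>j\<close> becomes column \<open>j\<close> plus t times column \<open>b\<close>. Comparing
  coefficients of powers of t replaces choosing values of t, which may be too few in a finite
  field.\<close>

definition shifted_var ::
  "'n \<Rightarrow> 'n \<Rightarrow> 'm \<times> 'n \<Rightarrow> (('m \<times> 'n \<Rightarrow>\<^sub>0 nat) \<Rightarrow>\<^sub>0 'k::comm_ring_1) poly"
  where "shifted_var j b = (\<lambda>(i, l). if l = j then [:var (i, j), var (i, b):] else [:var (i, l):])"

definition column_shift ::
  "'n::finite \<Rightarrow> 'n \<Rightarrow> (('m::finite \<times> 'n \<Rightarrow>\<^sub>0 nat) \<Rightarrow>\<^sub>0 'k::comm_ring_1)
    \<Rightarrow> (('m \<times> 'n \<Rightarrow>\<^sub>0 nat) \<Rightarrow>\<^sub>0 'k) poly"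
  where "column_shift j b = eval_poly_mapping (\<lambda>c. [:Poly_Mapping.single 0 c:]) (shifted_var j b)"

global_interpretation const_hom: unital_hom "\<lambda>c :: 'k::comm_ring_1.
    [:Poly_Mapping.single (0 :: 'v \<Rightarrow>\<^sub>0 nat) c:]"
proof
  fix a b :: 'k
  show "[:Poly_Mapping.single (0 :: 'v \<Rightarrow>\<^sub>0 nat) (a * b):] =
      [:Poly_Mapping.single 0 a:] * [:Poly_Mapping.single 0 b:]"
    by (simp add: mult_single mult.commute)
qed (simp_all add: single_add)

global_interpretation const_poly: unital_hom "\<lambda>c :: 'a::comm_ring_1. [:c:]"
  by unfold_locales simp_all

global_interpretation column_shift: unital_hom
  "column_shift j b :: (('m::finite \<times> 'n::finite \<Rightarrow>\<^sub>0 nat) \<Rightarrow>\<^sub>0 'k::comm_ring_1) \<Rightarrow> _"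
  for j b
  unfolding column_shift_def by (rule const_hom.unital_hom_eval)

lemma column_shift_var: "column_shift j b (var v) = shifted_var j b v"
  by (simp add: column_shift_def var_def const_hom.eval_single monomial_value_single)

lemma column_shift_mon:
  "column_shift j b (mon \<beta>) = (\<Prod>v\<in>UNIV. shifted_var j b v ^ Poly_Mapping.lookup \<beta> v)"
  by (simp add: column_shift_def const_hom.eval_single monomial_value_def)

text \<open>As \<open>j\<close> and \<open>b\<close> both lie in \<open>B\<close>, the operation
  adds a multiple of one column of the minor to another, and the result is constant in t.\<close>

lemma column_shift_minor:
  assumes "j \<in> B" "b \<in> B" "j \<noteq> b"
  shows "column_shift j b (minor_on (\<lambda>i l. var (i, l)) \<rho> B) = [:minor_on (\<lambda>i l. var (i, l)) \<rho> B:]"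
proof -
  have "column_shift j b (minor_on (\<lambda>i l. var (i, l)) \<rho> B) =
      minor_on (\<lambda>i l. shifted_var j b (i, l)) \<rho> B"
    by (simp only: column_shift.hom_minor_on column_shift_var)
  also have "(\<lambda>i l. shifted_var j b (i, l)) =
      (\<lambda>i l. if l = j then [:var (i, j):] + [:0, 1:] * [:var (i, b):] else [:var (i, l):])"
    by (intro ext) (simp add: shifted_var_def)
  also have "minor_on \<dots> \<rho> B = minor_on (\<lambda>i l. [:var (i, l):]) \<rho> B"
    using assms by (intro minor_on_add_column[where y = "\<lambda>i l. [:var (i, l):]"]) auto
  also have "\<dots> = [:minor_on (\<lambda>i l. var (i, l)) \<rho> B:]"
    by (simp only: const_poly.hom_minor_on)
  finally show ?thesis .
qed

text \<open>Valid beyond the degree too, where the binomial coefficient is 0; convolution sums then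
  need no case distinction.\<close>

lemma coeff_linear_power_any:
  "Polynomial.coeff ([:a, c:] ^ n) r = of_nat (n choose r) * c ^ r * a ^ (n - r)"
  for a c :: "'a::comm_ring_1"
proof (cases "r \<le> n")
  case True
  then show ?thesis by (rule coeff_linear_poly_power)
next
  case False
  have "degree ([:a, c:] ^ n) \<le> n"
    using degree_power_le[of "[:a, c:]" n] by (simp split: if_splits)
  with False show ?thesis
    by (simp add: coeff_eq_0 binomial_eq_0)
qed

text \<open>The polynomials whose shift has all coefficients in the ideal form an ideal, so
  generators suffice. Minors are fixed; the \<open>q\<close>-th power of a shifted variable keeps
  only its outer coefficients, which are \<open>q\<close>-th powers, since the inner binomials
  vanish.\<close>

lemma coeff_column_shift_mem:
  fixes f :: "('m::finite \<times> 'n::finite \<Rightarrow>\<^sub>0 nat) \<Rightarrow>\<^sub>0 'k::comm_ring_1"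
  assumes "prime CHAR('k)" "q = CHAR('k) ^ s" "j \<in> B" "b \<in> B" "j \<noteq> b"
    and "f \<in> minor_ideal q A B"
  shows "Polynomial.coeff (column_shift j b f) r \<in> minor_ideal q A B"
proof -
  let ?J = "minor_ideal q A B :: (('m \<times> 'n \<Rightarrow>\<^sub>0 nat) \<Rightarrow>\<^sub>0 'k) set"
  let ?K = "{f. \<forall>r. Polynomial.coeff (column_shift j b f) r \<in> ?J}"
  have choose_0: "(of_nat (q choose r) :: ('m \<times> 'n \<Rightarrow>\<^sub>0 nat) \<Rightarrow>\<^sub>0 'k) = 0" if "0 < r" "r < q" for r
  proof -
    have "(of_nat (q choose r) :: 'k) = 0"
      using prime_dvd_choose_prime_power[OF assms(1), of r s] that assms(2)
      by (simp add: of_nat_eq_0_iff_char_dvd)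
    then show ?thesis
      by (metis of_nat_0 single_of_nat single_zero)
  qed
  have "minor_ideal q A B \<subseteq> ?K"
  proof (rule minor_ideal_subset)
    show "ideal_span.subspace ?K"
    proof (rule ideal_span.subspaceI)
      show "c * f \<in> ?K" if "f \<in> ?K" for c f
        using that unfolding mem_Collect_eq column_shift.hom_mult coeff_mult
        by (intro allI ideal_span.subspace_sum[OF subspace_minor_ideal] minor_ideal_scale) auto
    qed (auto simp: column_shift.hom_0 column_shift.hom_add ideal_span.subspace_0[OF subspace_minor_ideal]
        intro: ideal_span.subspace_add[OF subspace_minor_ideal])
  next
    fix v :: "'m \<times> 'n"
    obtain i l where v: "v = (i, l)" by fastforce
    show "var v ^ q \<in> ?K"
    proof (cases "l = j")
      case True
      have "Polynomial.coeff (column_shift j b (var v ^ q :: _ \<Rightarrow>\<^sub>0 'k)) r =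
          of_nat (q choose r) * var (i, b) ^ r * var (i, j) ^ (q - r)" for r
        using True by (simp add: column_shift.hom_power column_shift_var shifted_var_def v
            coeff_linear_power_any)
      moreover have "of_nat (q choose r) * var (i, b) ^ r * var (i, j) ^ (q - r) \<in> ?J" for r
      proof -
        consider "r = 0" | "0 < r" "r < q" | "r = q" | "q < r" by linarith
        then show ?thesis
          by cases (use choose_0 var_power_in_minor_ideal in
              \<open>auto simp: binomial_eq_0 ideal_span.subspace_0[OF subspace_minor_ideal]\<close>)
      qed
      ultimately show ?thesis by simp
    next
      case False
      then show ?thesis
        by (auto simp: column_shift.hom_power column_shift_var shifted_var_def v poly_const_pow
            coeff_pCons var_power_in_minor_ideal ideal_span.subspace_0[OF subspace_minor_ideal]
            split: nat.splits)
    qed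
  next
    fix \<rho> :: "'n \<Rightarrow> 'm" assume "inj_on \<rho> B" "\<rho> ` B \<subseteq> A"
    then show "minor_on (\<lambda>i l. var (i, l)) \<rho> B \<in> ?K"
      using assms(3-5)
      by (auto simp: column_shift_minor coeff_pCons minor_in_minor_ideal
          ideal_span.subspace_0[OF subspace_minor_ideal] split: nat.splits)
  qed
  with assms(6) show ?thesis by blast
qed

text \<open>Each factor t replaces one variable by another, which costs at most one unit of degree
  in \<open>D\<close>. The property \<open>P\<close> expressing this is multiplicative, so checking
  the shifted variables is enough.\<close>

lemma coeff_column_shift_order_ge:
  fixes \<beta> :: "'m::finite \<times> 'n::finite \<Rightarrow>\<^sub>0 nat"
  shows "(Polynomial.coeff (column_shift j b (mon \<beta>)) r :: _ \<Rightarrow>\<^sub>0 'k::comm_ring_1)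
    \<in> order_ge D (degree_on D \<beta> - r)"
proof -
  define P :: "nat \<Rightarrow> (('m \<times> 'n \<Rightarrow>\<^sub>0 nat) \<Rightarrow>\<^sub>0 'k) poly \<Rightarrow> bool"
    where "P d f \<longleftrightarrow> (\<forall>r. Polynomial.coeff f r \<in> order_ge D (d - r))" for d f
  have mult: "P (d + e) (f * g)" if "P d f" "P e g" for d e f g
    unfolding P_def coeff_mult
  proof (intro allI ideal_span.subspace_sum[OF subspace_order_ge])
    fix r i :: nat assume "i \<in> {..r}"
    then have "d + e - r \<le> (d - i) + (e - (r - i))" by auto
    moreover have "Polynomial.coeff f i * Polynomial.coeff g (r - i) \<in> order_ge D ((d - i) + (e - (r - i)))"
      using that by (intro order_ge_mult) (auto simp: P_def)
    ultimately show "Polynomial.coeff f i * Polynomial.coeff g (r - i) \<in> order_ge D (d + e - r)"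
      using order_ge_mono by blast
  qed
  have one: "P 0 1"
    by (simp add: P_def order_ge_0)
  have power: "P (n * d) (f ^ n)" if "P d f" for n d f
    by (induction n) (use one mult that in auto)
  have prod: "P (\<Sum>v\<in>V. d v) (\<Prod>v\<in>V. f v)" if "\<And>v. v \<in> V \<Longrightarrow> P (d v) (f v)" for V :: "('m \<times> 'n) set" and d f
    using that by (induction V rule: infinite_finite_induct) (use one mult in auto)
  have var: "P (if v \<in> D then 1 else 0) (shifted_var j b v)" for v
  proof (cases "v \<in> D")
    case True
    then show ?thesis
      using var_in_order_ge[of D v]
      by (auto simp: P_def shifted_var_def coeff_pCons order_ge_0 ideal_span.subspace_0[OF subspace_order_ge]
          split: nat.splits prod.splits)
  qed (simp add: P_def order_ge_0)
  have "P (\<Sum>v\<in>UNIV. Poly_Mapping.lookup \<beta> v * (if v \<in> D then 1 else 0)) (column_shift j b (mon \<beta>))"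
    unfolding column_shift_mon by (intro prod power var)
  moreover have "(\<Sum>v\<in>UNIV. Poly_Mapping.lookup \<beta> v * (if v \<in> D then 1 else 0)) = degree_on D \<beta>"
    by (simp add: degree_on_def if_distrib sum.If_cases cong: if_cong)
  ultimately show ?thesis
    by (simp add: P_def)
qed

text \<open>At t = 0 the column operation is the identity.\<close>

lemma coeff_0_column_shift:
  fixes \<beta> :: "'m::finite \<times> 'n::finite \<Rightarrow>\<^sub>0 nat"
  shows "Polynomial.coeff (column_shift j b (mon \<beta>)) 0 = (mon \<beta> :: _ \<Rightarrow>\<^sub>0 'k::comm_ring_1)"
proof -
  have "poly (shifted_var j b v) 0 = (var v :: _ \<Rightarrow>\<^sub>0 'k)" for v :: "'m \<times> 'n"
    by (cases v) (simp add: shifted_var_def)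
  then have "poly (column_shift j b (mon \<beta>)) 0 = (mon \<beta> :: _ \<Rightarrow>\<^sub>0 'k)"
    unfolding column_shift_mon poly_prod by (simp add: mon_eq_prod)
  then show ?thesis
    by (simp add: poly_0_coeff_0)
qed

section \<open>The vanishing degree\<close>

definition row_mon :: "'m \<Rightarrow> 'n set \<Rightarrow> ('n \<Rightarrow> nat) \<Rightarrow> (('m \<times> 'n \<Rightarrow>\<^sub>0 nat) \<Rightarrow>\<^sub>0 'k::comm_ring_1)"
  where "row_mon i B u = (\<Prod>l\<in>B. var (i, l) ^ u l)"

lemma row_mon_remove: "finite B \<Longrightarrow> b \<in> B \<Longrightarrow> row_mon i B u = var (i, b) ^ u b * row_mon i (B - {b}) u"
  by (simp add: row_mon_def prod.remove)

lemma row_mon_cong: "(\<And>l. l \<in> B \<Longrightarrow> u l = w l) \<Longrightarrow> row_mon i B u = row_mon i B w"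
  by (simp add: row_mon_def)

lemma column_shift_row_mon:
  "j \<notin> B \<Longrightarrow> column_shift j b (row_mon i B u) = [:row_mon i B u:]"
proof -
  assume "j \<notin> B"
  then have "column_shift j b (row_mon i B u) = (\<Prod>l\<in>B. [:var (i, l) ^ u l:])"
    unfolding row_mon_def column_shift.hom_prod
    by (intro prod.cong) (auto simp: column_shift.hom_power column_shift_var shifted_var_def poly_const_pow)
  then show ?thesis
    by (simp only: row_mon_def const_poly.hom_prod)
qed

text \<open>Modulo \<open>q\<close>-th powers, \<open>?W\<close> annihilates the entries of row
  \<open>i\<close> in the columns \<open>B - {b}\<close>. Hence \<open>?W * var (i, b)\<close>
  carries each smaller minor into the larger ideal; \<open>0 < u b\<close> supplies the factor
  \<open>var (i, b)\<close>.\<close>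

lemma full_row_mon_mem:
  fixes A :: "'m::finite set" and B :: "'n::finite set"
    and f :: "('m \<times> 'n \<Rightarrow>\<^sub>0 nat) \<Rightarrow>\<^sub>0 'k::comm_ring_1"
  assumes "0 < q" "i \<in> A" "b \<in> B" "f \<in> minor_ideal q (A - {i}) (B - {b})"
    and u: "\<And>l. l \<in> B - {b} \<Longrightarrow> u l = q - 1" "0 < u b"
  shows "row_mon i B u * f \<in> minor_ideal q A B"
proof -
  let ?J = "minor_ideal q A B :: (('m \<times> 'n \<Rightarrow>\<^sub>0 nat) \<Rightarrow>\<^sub>0 'k) set"
    and ?W = "row_mon i (B - {b}) (\<lambda>_. q - 1) :: ('m \<times> 'n \<Rightarrow>\<^sub>0 nat) \<Rightarrow>\<^sub>0 'k"
  let ?y = "\<lambda>i l. var (i, l) :: ('m \<times> 'n \<Rightarrow>\<^sub>0 nat) \<Rightarrow>\<^sub>0 'k"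
  have "minor_ideal q (A - {i}) (B - {b}) \<subseteq> {f. (?W * var (i, b)) * f \<in> ?J}"
  proof (rule minor_ideal_subset)
    show "ideal_span.subspace {f. (?W * var (i, b)) * f \<in> ?J}"
      by (rule subspace_colon[OF subspace_minor_ideal])
    show "var v ^ q \<in> {f. (?W * var (i, b)) * f \<in> ?J}" for v
      by (auto intro: minor_ideal_scale var_power_in_minor_ideal)
    fix \<rho> assume \<rho>: "inj_on \<rho> (B - {b})" "\<rho> ` (B - {b}) \<subseteq> A - {i}"
    \<comment> \<open>Row \<open>i\<close> is placed at position \<open>b\<close>; injectivity holds
      because \<open>\<rho>\<close> avoids \<open>i\<close>.\<close>
    let ?\<rho> = "\<rho>(b := i)"
    have B: "B = insert b (B - {b})" using assms(3) by auto
    have "inj_on ?\<rho> (insert b (B - {b}))"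
      using \<rho> by (subst inj_on_insert) (auto simp: inj_on_def)
    then have "inj_on ?\<rho> B" using B by simp
    moreover have "?\<rho> ` B \<subseteq> A"
      using \<rho>(2) assms(2) by auto
    ultimately have "minor_on ?y ?\<rho> B \<in> ?J"
      by (rule minor_in_minor_ideal)
    then have minor: "?W * minor_on ?y ?\<rho> B \<in> ?J"
      by (rule minor_ideal_scale)
    have "?W * ?y (?\<rho> b) l \<in> ?J" if "l \<in> B - {b}" for l
    proof -
      have W: "?W = var (i, l) ^ (q - 1) * row_mon i (B - {b} - {l}) (\<lambda>_. q - 1)"
        using that by (intro row_mon_remove) auto
      have "?W * ?y (?\<rho> b) l = row_mon i (B - {b} - {l}) (\<lambda>_. q - 1) * (var (i, l) ^ (q - 1) * var (i, l))"
        unfolding W by (simp add: mult_ac)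
      also have "var (i, l) ^ (q - 1) * var (i, l) = var (i, l) ^ q"
        using assms(1) by (rule power_minus_mult)
      finally show ?thesis
        by (simp only: minor_ideal_scale[OF var_power_in_minor_ideal])
    qed
    then have "?W * minor_on ?y ?\<rho> B - ?W * ?y (?\<rho> b) b * minor_on ?y ?\<rho> (B - {b}) \<in> ?J"
      by (intro minor_on_expand assms(3) subspace_minor_ideal) auto
    then have "?W * ?y (?\<rho> b) b * minor_on ?y ?\<rho> (B - {b}) \<in> ?J"
      using ideal_span.subspace_diff[OF subspace_minor_ideal minor] by fastforce
    moreover have "minor_on ?y ?\<rho> (B - {b}) = minor_on ?y \<rho> (B - {b})"
      unfolding minor_on_def by (intro sum.cong refl arg_cong2[of _ _ _ _ "(*)"] prod.cong) auto
    ultimately show "minor_on ?y \<rho> (B - {b}) \<in> {f. (?W * var (i, b)) * f \<in> ?J}"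
      by simp
  qed
  with assms(4) have "(?W * var (i, b)) * f \<in> ?J"
    by blast
  then have "var (i, b) ^ (u b - 1) * ((?W * var (i, b)) * f) \<in> ?J"
    by (rule minor_ideal_scale)
  moreover have "row_mon i B u = (var (i, b) ^ (u b - 1) * var (i, b)) * ?W"
  proof -
    have "row_mon i B u = var (i, b) ^ u b * row_mon i (B - {b}) u"
      using assms(3) by (intro row_mon_remove) auto
    also have "row_mon i (B - {b}) u = ?W"
      using u(1) by (rule row_mon_cong)
    also have "var (i, b) ^ u b = (var (i, b) ^ (u b - 1) * var (i, b) :: _ \<Rightarrow>\<^sub>0 'k)"
      using u(2) by (rule power_minus_mult[symmetric])
    finally show ?thesis .
  qed
  ultimately show ?thesis
    by (simp add: mult_ac)
qed

text \<open>
  Induction on the total deficiency \<open>\<Sum>l. q - 1 - u l\<close>. Filling up the exponent in column \<open>j\<close> at the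
  expense of column \<open>b\<close> gives a monomial of smaller deficiency. Its image under the column
  operation \<open>x\<^sub>i\<^sub>j \<mapsto> x\<^sub>i\<^sub>j + t x\<^sub>i\<^sub>b\<close> has the original monomial in the coefficient of the appropriate power
  of \<open>t\<close>, up to sign and monomials of smaller deficiency.
\<close>

lemma row_mon_mult_mem:
  fixes A :: "'m::finite set" and B :: "'n::finite set"
    and \<beta> :: "'m \<times> 'n \<Rightarrow>\<^sub>0 nat" and i :: 'm and b :: 'n
  defines "D \<equiv> (A - {i}) \<times> (B - {b})"
  assumes p: "prime CHAR('k::comm_ring_1)" "q = CHAR('k) ^ s" and "i \<in> A" "b \<in> B"
    and IH: "\<And>\<beta>. E \<le> degree_on D \<beta> \<Longrightarrow> (mon \<beta> :: _ \<Rightarrow>\<^sub>0 'k) \<in> minor_ideal q (A - {i}) (B - {b})"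
    and u: "\<And>l. l \<in> B - {b} \<Longrightarrow> u l \<le> q - 1"
      "(\<Sum>l\<in>B - {b}. q - 1 - u l) < u b"
      "E + card (B - {b}) * (q - 1) \<le> degree_on D \<beta> + (\<Sum>l\<in>B - {b}. u l)"
  shows "row_mon i B u * (mon \<beta> :: _ \<Rightarrow>\<^sub>0 'k) \<in> minor_ideal q A B"
  using u
proof (induction "\<Sum>l\<in>B - {b}. q - 1 - u l" arbitrary: u \<beta> rule: less_induct)
  case less
  let ?J = "minor_ideal q A B :: (('m \<times> 'n \<Rightarrow>\<^sub>0 nat) \<Rightarrow>\<^sub>0 'k) set"
  have "0 < q" using p by (simp add: prime_gt_0_nat)
  show ?case
  proof (cases "\<forall>l\<in>B - {b}. u l = q - 1")
    case True
    then have "E \<le> degree_on D \<beta>"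
      using less.prems(3) by simp
    then have "(mon \<beta> :: _ \<Rightarrow>\<^sub>0 'k) \<in> minor_ideal q (A - {i}) (B - {b})"
      by (rule IH)
    then show ?thesis
      using True less.prems(2) \<open>0 < q\<close> \<open>i \<in> A\<close> \<open>b \<in> B\<close>
      by (intro full_row_mon_mem) auto
  next
    case False
    then obtain j where j: "j \<in> B - {b}" "u j < q - 1"
      using less.prems(1) by (metis le_neq_implies_less)
    \<comment> \<open>The exponent missing in column \<open>j\<close>, which is also the power of t
      whose coefficient is compared below.\<close>
    define r where "r = q - 1 - u j"
    have sum_split: "(\<Sum>l\<in>B - {b}. f l) = f j + (\<Sum>l\<in>B - {b} - {j}. f l)" for f :: "'n \<Rightarrow> nat"
      by (rule sum.remove) (use j in auto)
    \<comment> \<open>A family interpolating between \<open>w 0\<close>, which is full in column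
      \<open>j\<close> at the expense of column \<open>b\<close>, and
      \<open>w r = u\<close>.\<close>
    define w where "w k = u(j := q - 1 - k, b := u b - r + k)" for k
    have w_j: "w k j = q - 1 - k" and w_b: "w k b = u b - r + k" for k
      using j by (auto simp: w_def)
    have w_other: "(\<Sum>l\<in>B - {b} - {j}. f l (w k l)) = (\<Sum>l\<in>B - {b} - {j}. f l (u l))"
      for k and f :: "'n \<Rightarrow> nat \<Rightarrow> nat"
      by (rule sum.cong) (auto simp: w_def)
    let ?defect = "\<Sum>l\<in>B - {b} - {j}. q - 1 - u l"
    \<comment> \<open>In particular \<open>r \<le> u b\<close>, so the subtraction in
      \<open>w\<close> is not truncated.\<close>
    have "r + ?defect < u b"
      using less.prems(2) sum_split[of "\<lambda>l. q - 1 - u l"] by (simp add: r_def)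
    \<comment> \<open>Compared with \<open>u\<close>, \<open>w k\<close> has \<open>r - k\<close>
      more in column \<open>j\<close>. This pays for a loss of \<open>r - k\<close> in
      \<open>D\<close>-degree, which is what the coefficient of t to the power \<open>r - k\<close>
      may cost.\<close>
    have mem: "row_mon i B (w k) * (mon \<gamma> :: _ \<Rightarrow>\<^sub>0 'k) \<in> ?J"
      if "k < r" "degree_on D \<beta> \<le> degree_on D \<gamma> + (r - k)" for k \<gamma>
    proof (rule less.hyps)
      show "(\<Sum>l\<in>B - {b}. q - 1 - w k l) < (\<Sum>l\<in>B - {b}. q - 1 - u l)"
        using that j w_other[of "\<lambda>l m. q - 1 - m" k] by (simp add: sum_split w_j r_def)
      show "w k l \<le> q - 1" if "l \<in> B - {b}" for l
        using less.prems(1) that by (auto simp: w_def)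
      show "(\<Sum>l\<in>B - {b}. q - 1 - w k l) < w k b"
        using that j w_other[of "\<lambda>l m. q - 1 - m" k] \<open>r + ?defect < u b\<close> 
        by (simp add: sum_split w_j w_b r_def)
      show "E + card (B - {b}) * (q - 1) \<le> degree_on D \<gamma> + (\<Sum>l\<in>B - {b}. w k l)"
        using that j less.prems(3) w_other[of "\<lambda>l m. m" k] by (simp add: sum_split w_j r_def)
    qed
    define N :: "('m \<times> 'n \<Rightarrow>\<^sub>0 nat) \<Rightarrow>\<^sub>0 'k" where "N = row_mon i (B - {b} - {j}) u"
    have row_w: "row_mon i B (w k) = var (i, b) ^ (u b - r) * (var (i, b) ^ k * (var (i, j) ^ (q - 1 - k) * N))" for k
    proof -
      have "row_mon i B (w k) = var (i, b) ^ w k b * row_mon i (B - {b}) (w k)"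
        using \<open>b \<in> B\<close> by (intro row_mon_remove) auto
      also have "row_mon i (B - {b}) (w k) = var (i, j) ^ w k j * row_mon i (B - {b} - {j}) (w k)"
        using j(1) by (intro row_mon_remove) auto
      also have "row_mon i (B - {b} - {j}) (w k) = N"
        unfolding N_def by (rule row_mon_cong) (auto simp: w_def)
      finally show ?thesis
        by (simp only: w_j w_b power_add mult.assoc)
    qed
    let ?F = "column_shift j b (mon \<beta> :: _ \<Rightarrow>\<^sub>0 'k)"
    have shift: "column_shift j b (row_mon i B (w 0) * mon \<beta>) =
        [:var (i, b) ^ (u b - r) * N:] * ([:var (i, j), var (i, b):] ^ (q - 1) * ?F)"
    proof -
      have "column_shift j b (var (i, b) :: _ \<Rightarrow>\<^sub>0 'k) = [:var (i, b):]"
        using j by (auto simp: column_shift_var shifted_var_def)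
      moreover have "column_shift j b (var (i, j) :: _ \<Rightarrow>\<^sub>0 'k) = [:var (i, j), var (i, b):]"
        by (simp add: column_shift_var shifted_var_def)
      moreover have "column_shift j b N = [:N:]"
        unfolding N_def by (rule column_shift_row_mon) simp
      ultimately show ?thesis
        by (simp only: row_w column_shift.hom_mult column_shift.hom_power const_poly.hom_mult
            const_poly.hom_power power_0 mult_1 diff_zero mult_ac)
    qed
    \<comment> \<open>Of the \<open>r\<close> factors t, \<open>k\<close> come from row
      \<open>i\<close> and \<open>r - k\<close> from \<open>?F\<close>.\<close>
    have coeff_shift: "Polynomial.coeff (column_shift j b (row_mon i B (w 0) * mon \<beta>)) r =
        (\<Sum>k\<le>r. (of_nat (q - 1 choose k) * row_mon i B (w k)) * Polynomial.coeff ?F (r - k))"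
    proof -
      have "Polynomial.coeff (column_shift j b (row_mon i B (w 0) * mon \<beta>)) r =
          (\<Sum>k\<le>r. (var (i, b) ^ (u b - r) * N) *
            (Polynomial.coeff ([:var (i, j), var (i, b):] ^ (q - 1)) k * Polynomial.coeff ?F (r - k)))"
        unfolding shift by (simp add: coeff_mult sum_distrib_left)
      then show ?thesis
        by (simp only: coeff_linear_power_any row_w mult_ac)
    qed
    have "0 < r" using j by (simp add: r_def)
    \<comment> \<open>The shifted monomial is in the ideal by \<open>mem\<close> with
      \<open>k = 0\<close>; here \<open>0 < r\<close> matters.\<close>
    have "Polynomial.coeff (column_shift j b (row_mon i B (w 0) * mon \<beta>)) r \<in> ?J"
      by (intro coeff_column_shift_mem[OF p] mem) (use j \<open>b \<in> B\<close> \<open>0 < r\<close> in auto)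
    then have sum: "(\<Sum>k<r. of_nat (q - 1 choose k) * row_mon i B (w k) * Polynomial.coeff ?F (r - k)) +
        of_nat (q - 1 choose r) * row_mon i B (w r) * Polynomial.coeff ?F (r - r) \<in> ?J"
      by (simp only: coeff_shift lessThan_Suc_atMost[symmetric] sum.lessThan_Suc)
    have "of_nat (q - 1 choose k) * row_mon i B (w k) * Polynomial.coeff ?F (r - k) \<in> ?J"
      if "k < r" for k
    proof -
      have "order_ge D (degree_on D \<beta> - (r - k)) \<subseteq> {f. row_mon i B (w k) * f \<in> ?J}"
        using mem[OF that] 
        by (intro order_ge_subset_ideal subspace_colon subspace_minor_ideal) (simp add: le_diff_conv)
      then have "row_mon i B (w k) * Polynomial.coeff ?F (r - k) \<in> ?J"
        using coeff_column_shift_order_ge by blast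
      then show ?thesis
        by (simp only: mult.assoc minor_ideal_scale)
    qed
    then have "(\<Sum>k<r. of_nat (q - 1 choose k) * row_mon i B (w k) * Polynomial.coeff ?F (r - k)) \<in> ?J"
      by (intro ideal_span.subspace_sum[OF subspace_minor_ideal]) auto
    from ideal_span.subspace_diff[OF subspace_minor_ideal sum this]
    have "of_nat (q - 1 choose r) * row_mon i B (w r) * Polynomial.coeff ?F (r - r) \<in> ?J"
      by (simp only: add_diff_cancel_left')
    \<comment> \<open>The surviving term \<open>k = r\<close> is the original monomial, because
      \<open>w r = u\<close> and the constant coefficient of \<open>?F\<close> is
      \<open>mon \<beta>\<close>. Its coefficient is a unit and can be cancelled.\<close>
    moreover have "(of_nat (q - 1 choose r) :: ('m \<times> 'n \<Rightarrow>\<^sub>0 nat) \<Rightarrow>\<^sub>0 'k) = (-1) ^ r"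
    proof -
      have "(of_nat CHAR('k) :: ('m \<times> 'n \<Rightarrow>\<^sub>0 nat) \<Rightarrow>\<^sub>0 'k) = 0"
        by (metis of_nat_CHAR single_of_nat single_zero)
      from choose_prime_power_minus_1[OF p(1) this, of r s] show ?thesis
        using p(2) by (simp add: r_def)
    qed
    ultimately have "(-1) ^ r * (row_mon i B (w r) * mon \<beta>) \<in> ?J"
      by (simp add: coeff_0_column_shift mult.assoc)
    then have "(-1) ^ r * ((-1) ^ r * (row_mon i B (w r) * mon \<beta>)) \<in> ?J"
      by (rule minor_ideal_scale)
    moreover have "w r = u"
      using j \<open>r + ?defect < u b\<close> by (auto simp: w_def r_def fun_eq_iff)
    ultimately show ?thesis
      by (simp flip: mult.assoc power_mult_distrib)
  qed
qed

text \<open>Here \<open>a\<close> and \<open>n\<close> count rows and columns, \<open>t\<close> is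
  \<open>q - 1\<close>, \<open>d\<close> is the degree and \<open>c\<close> that of the lightest
  column. Since \<open>d - c\<close> is at least \<open>(n - 1) / n\<close> times \<open>d\<close>,
  the claim reduces to an inequality whose two sides differ by a multiple of
  \<open>a - n\<close>.\<close>

lemma degree_bound_arith:
  fixes a n c d t :: nat
  assumes "2 \<le> n" "n \<le> a" "n * c \<le> d" "a * (n - 1) * t < d"
  shows "(a - 1) * (n - 2) * t + 1 + (n - 1) * t \<le> d - c"
proof (rule ccontr)
  assume "\<not> ?thesis"
  then have *: "d - c \<le> ((a - 1) * (n - 2) + (n - 1)) * t"
    by (simp add: distrib_right)
  \<comment> \<open>Writing \<open>n\<close> and \<open>a\<close> as sums removes truncated
    subtraction from the polynomial identity below.\<close>
  obtain m where m: "n = m + 2" using assms(1) by (metis add.commute le_Suc_ex)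
  obtain e where e: "a = m + 2 + e" using assms(2) m by (metis le_Suc_ex)
  have "c \<le> d" using assms(1,3) by (cases n) auto
  have "(n - 1) * d + n * c \<le> (n - 1) * d + d"
    using assms(3) by simp
  also have "\<dots> = n * d" using assms(1) by (cases n) auto
  also have "\<dots> = n * (d - c) + n * c" using \<open>c \<le> d\<close> by (metis add_mult_distrib2 le_add_diff_inverse2)
  finally have "(n - 1) * d \<le> n * (d - c)" by simp
  also have "\<dots> \<le> n * (((a - 1) * (n - 2) + (n - 1)) * t)"
    using * by (rule mult_le_mono2)
  also have "\<dots> \<le> (n - 1) * (a * (n - 1) * t)"
  proof -
    have "n * ((a - 1) * (n - 2) + (n - 1)) + e = (n - 1) * (a * (n - 1))"
      by (simp add: m e algebra_simps)
    then have "n * ((a - 1) * (n - 2) + (n - 1)) \<le> (n - 1) * (a * (n - 1))" by linarith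
    then show ?thesis
      using mult_le_mono1[of _ _ t] by (simp add: mult.assoc)
  qed
  finally have "d \<le> a * (n - 1) * t"
    using assms(1) by (subst (asm) mult_le_cancel1) linarith
  with assms(4) show False by simp
qed

text \<open>The upper bound for monomials, with row and column sets as parameters so that the
  induction can pass to a smaller matrix.\<close>

lemma mon_in_minor_ideal:
  fixes A :: "'m::finite set" and B :: "'n::finite set" and \<beta> :: "'m \<times> 'n \<Rightarrow>\<^sub>0 nat"
  assumes p: "prime CHAR('k::comm_ring_1)" "q = CHAR('k) ^ s"
    and "B \<noteq> {}" "card B \<le> card A"
    and "card A * (card B - 1) * (q - 1) < degree_on (A \<times> B) \<beta>"
  shows "(mon \<beta> :: _ \<Rightarrow>\<^sub>0 'k) \<in> minor_ideal q A B"
  using assms(3-)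
proof (induction "card B" arbitrary: A B \<beta>)
  case 0
  then show ?case by simp
next
  case (Suc n)
  note card_B = Suc.hyps(2)[symmetric]
  let ?J = "minor_ideal q A B :: (('m \<times> 'n \<Rightarrow>\<^sub>0 nat) \<Rightarrow>\<^sub>0 'k) set"
  let ?\<beta> = "\<lambda>i l. Poly_Mapping.lookup \<beta> (i, l)"
  have rows: "degree_on (A \<times> B) \<beta> = (\<Sum>i\<in>A. \<Sum>l\<in>B. ?\<beta> i l)"
    by (simp add: degree_on_def sum.cartesian_product)
  then have cols: "degree_on (A \<times> B) \<beta> = (\<Sum>l\<in>B. \<Sum>i\<in>A. ?\<beta> i l)"
    by (simp only: sum.swap[of _ B])
  show ?case
  proof (cases "n = 0")
    case True
    then obtain b where B: "B = {b}"
      using Suc.hyps(2) by (metis One_nat_def card_1_singletonE)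
    \<comment> \<open>With one column the degree bound is 0 and the minors are the variables
      themselves.\<close>
    have "\<exists>i\<in>A. ?\<beta> i b \<noteq> 0"
      using Suc.prems(3) rows B by (auto intro: ccontr)
    then obtain i where i: "i \<in> A" "?\<beta> i b \<noteq> 0" by blast
    have "minor_on (\<lambda>i l. var (i, l)) (\<lambda>_. i) B \<in> ?J"
      using i(1) B by (intro minor_in_minor_ideal) auto
    then have "var (i, b) ^ 1 \<in> ?J"
      by (simp add: minor_on_def B)
    from mon_mem_if_power_mem[OF subspace_minor_ideal this] show ?thesis
      using i(2) by simp
  next
    case False
    define t where "t = q - 1"
    consider (large) v where "q \<le> Poly_Mapping.lookup \<beta> v" | (small) "\<forall>v. Poly_Mapping.lookup \<beta> v < q"
      using not_le by blast
    then show ?thesis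
    proof cases
      case large
      then show ?thesis
        by (intro mon_mem_if_power_mem[OF subspace_minor_ideal var_power_in_minor_ideal])
    next
      case small
      then have small: "Poly_Mapping.lookup \<beta> v \<le> t" for v
        by (metis t_def Suc_pred' diff_Suc_1 less_Suc_eq_le not_less_zero neq0_conv)
      \<comment> \<open>Pigeonhole over the rows, with \<open>n = card B - 1\<close>.\<close>
      have "\<exists>i\<in>A. n * t < (\<Sum>l\<in>B. ?\<beta> i l)"
      proof (rule ccontr)
        assume "\<not> ?thesis"
        then have "degree_on (A \<times> B) \<beta> \<le> card A * (n * t)"
          unfolding rows using sum_bounded_above[of A "\<lambda>i. \<Sum>l\<in>B. ?\<beta> i l" "n * t"] by (auto simp: not_less)
        with Suc.prems(3) show False by (simp add: card_B t_def mult.assoc)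
      qed
      then obtain i where i: "i \<in> A" "n * t < (\<Sum>l\<in>B. ?\<beta> i l)" by blast
      define c where "c b = (\<Sum>i\<in>A. ?\<beta> i b)" for b
      \<comment> \<open>Deleting a column of least degree costs at most the average column
        degree.\<close>
      obtain b where b: "b \<in> B" "\<And>l. l \<in> B \<Longrightarrow> c b \<le> c l"
        using arg_min_if_finite[of B c] Suc.prems(1) by (metis finite linorder_not_le)
      have col: "card B * c b \<le> degree_on (A \<times> B) \<beta>"
        unfolding cols c_def[symmetric] using sum_bounded_below[of B "c b" c] b(2) by simp
      let ?D = "(A - {i}) \<times> (B - {b})"
      \<comment> \<open>\<open>\<rho>\<close> is the part of \<open>\<beta>\<close> in row
        \<open>i\<close> and columns \<open>B\<close>; \<open>\<gamma>\<close> keeps the rest,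
        including variables outside \<open>A \<times> B\<close>.\<close>
      define \<rho> where "\<rho> = (\<Sum>l\<in>B. Poly_Mapping.single (i, l) (?\<beta> i l))"
      have \<rho>: "Poly_Mapping.lookup \<rho> (k, l) = (if k = i \<and> l \<in> B then ?\<beta> i l else 0)" for k l
        by (auto simp: \<rho>_def lookup_sum lookup_single when_def)
      define \<gamma> where "\<gamma> = \<beta> - \<rho>"
      have "mon \<beta> = mon \<rho> * mon \<gamma>"
        unfolding \<gamma>_def by (rule mon_split) (auto simp: \<rho> split_paired_all)
      also have "(mon \<rho> :: _ \<Rightarrow>\<^sub>0 'k) = row_mon i B (?\<beta> i)"
      proof -
        have "(mon (\<Sum>l\<in>C. Poly_Mapping.single (i, l) (?\<beta> i l)) :: _ \<Rightarrow>\<^sub>0 'k) = row_mon i C (?\<beta> i)" for C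
          by (induction C rule: infinite_finite_induct) (simp_all add: row_mon_def mon_add var_power)
        then show ?thesis by (simp add: \<rho>_def)
      qed
      also have "row_mon i B (?\<beta> i) * (mon \<gamma> :: _ \<Rightarrow>\<^sub>0 'k) \<in> ?J"
      proof (rule row_mon_mult_mem[OF p i(1) b(1)])
        \<comment> \<open>The least degree strictly above the induction bound for one row and one
          column fewer, hence \<open>card B - 2\<close> and \<open>+ 1\<close>.\<close>
        let ?E = "(card A - 1) * (card B - 2) * t + 1"
        have card: "card (A - {i}) = card A - 1" "card (B - {b}) = n"
          using i(1) b(1) card_B by simp_all
        show "(mon \<alpha> :: _ \<Rightarrow>\<^sub>0 'k) \<in> minor_ideal q (A - {i}) (B - {b})" if "?E \<le> degree_on ?D \<alpha>" for \<alpha>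
        proof (rule Suc.hyps(1))
          show "B - {b} \<noteq> {}" using False card by (metis card.empty)
          show "card (A - {i}) * (card (B - {b}) - 1) * (q - 1) < degree_on ?D \<alpha>"
            using that card by (simp add: card_B t_def)
        qed (use card Suc.prems(2) card_B in simp_all)
        show "?\<beta> i l \<le> q - 1" for l
          using small[of "(i, l)"] by (simp add: t_def)
        have row_split: "(\<Sum>l\<in>B. ?\<beta> i l) = ?\<beta> i b + (\<Sum>l\<in>B - {b}. ?\<beta> i l)"
          using b(1) by (intro sum.remove) auto
        \<comment> \<open>Deficiencies and exponents outside \<open>b\<close> add up to
          \<open>n * t\<close>, so a row degree above \<open>n * t\<close> says that the exponent at
          \<open>b\<close> exceeds the total deficiency.\<close>
        have "(\<Sum>l\<in>B - {b}. t - ?\<beta> i l) + (\<Sum>l\<in>B - {b}. ?\<beta> i l) = n * t"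
          using small card unfolding sum.distrib[symmetric] by simp
        with i(2) row_split show "(\<Sum>l\<in>B - {b}. q - 1 - ?\<beta> i l) < ?\<beta> i b"
          unfolding t_def[symmetric] by linarith
        have "degree_on ?D \<gamma> = (\<Sum>l\<in>B - {b}. \<Sum>k\<in>A - {i}. ?\<beta> k l)"
        proof -
          have "degree_on ?D \<gamma> = (\<Sum>k\<in>A - {i}. \<Sum>l\<in>B - {b}. ?\<beta> k l)"
            unfolding degree_on_def sum.cartesian_product
            by (intro sum.cong refl) (auto simp: \<gamma>_def lookup_minus \<rho>)
          then show ?thesis by (simp only: sum.swap[of _ "B - {b}"])
        qed
        moreover have "(\<Sum>k\<in>A. ?\<beta> k l) = ?\<beta> i l + (\<Sum>k\<in>A - {i}. ?\<beta> k l)" for l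
          using i(1) by (intro sum.remove) auto
        moreover have "degree_on (A \<times> B) \<beta> = c b + (\<Sum>l\<in>B - {b}. \<Sum>k\<in>A. ?\<beta> k l)"
          unfolding cols c_def using b(1) by (intro sum.remove) auto
        \<comment> \<open>Both sides count the degree in \<open>A \<times> B\<close> outside column
          \<open>b\<close>.\<close>
        ultimately have "degree_on ?D \<gamma> + (\<Sum>l\<in>B - {b}. ?\<beta> i l) = degree_on (A \<times> B) \<beta> - c b"
          by (simp add: sum.distrib)
        moreover have "?E + (card B - 1) * t \<le> degree_on (A \<times> B) \<beta> - c b"
          using False card_B Suc.prems col by (intro degree_bound_arith) (auto simp: t_def)
        ultimately show "?E + card (B - {b}) * (q - 1) \<le> degree_on ?D \<gamma> + (\<Sum>l\<in>B - {b}. ?\<beta> i l)"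
          using card by (simp add: card_B t_def)
      qed
      finally show ?thesis .
    qed
  qed
qed

section \<open>Quotients of type-class rings\<close>

lemma type_algebra_simps:
  "carrier ring_of_type_algebra = UNIV" "x \<otimes>\<^bsub>ring_of_type_algebra\<^esub> y = x * y"
  "\<one>\<^bsub>ring_of_type_algebra\<^esub> = 1" "\<zero>\<^bsub>ring_of_type_algebra\<^esub> = 0"
  "x \<oplus>\<^bsub>ring_of_type_algebra\<^esub> y = x + y"
  by (simp_all add: ring_of_type_algebra_def)

lemma type_algebra_a_inv: "\<ominus>\<^bsub>ring_of_type_algebra\<^esub> x = - x" for x :: "'a::comm_ring_1"
proof -
  interpret ring "ring_of_type_algebra :: 'a ring" by (rule ring_from_type_algebra)
  show ?thesis
    by (rule minus_equality) (simp_all add: type_algebra_simps)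
qed

lemma type_algebra_power: "x [^]\<^bsub>ring_of_type_algebra\<^esub> n = x ^ n" for x :: "'a::comm_ring_1" and n :: nat
proof -
  interpret ring "ring_of_type_algebra :: 'a ring" by (rule ring_from_type_algebra)
  show ?thesis
    by (induction n) (simp_all add: type_algebra_simps mult.commute)
qed

lemma ideal_type_algebra_iff:
  "ideal I (ring_of_type_algebra :: 'a::comm_ring_1 ring) \<longleftrightarrow> ideal_span.subspace I"
proof
  assume "ideal I (ring_of_type_algebra :: 'a ring)"
  then interpret ideal I "ring_of_type_algebra :: 'a ring" .
  show "ideal_span.subspace I"
    using additive_subgroup.zero_closed[OF is_additive_subgroup]
      additive_subgroup.a_closed[OF is_additive_subgroup] I_l_closed
    by (intro ideal_span.subspaceI) (simp_all add: type_algebra_simps)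
next
  assume I: "ideal_span.subspace I"
  interpret ring "ring_of_type_algebra :: 'a ring" by (rule ring_from_type_algebra)
  have "subgroup I (add_monoid (ring_of_type_algebra :: 'a ring))"
  proof (rule add.subgroupI)
    show "I \<noteq> {}" using ideal_span.subspace_0[OF I] by auto
    show "\<ominus>\<^bsub>ring_of_type_algebra\<^esub> a \<in> I" if "a \<in> I" for a
      using ideal_span.subspace_neg[OF I that] by (simp add: type_algebra_a_inv)
  qed (use ideal_span.subspace_add[OF I] in \<open>auto simp: type_algebra_simps\<close>)
  then show "ideal I (ring_of_type_algebra :: 'a ring)"
    using ideal_span.subspace_scale[OF I]
    by (intro idealI ring_from_type_algebra) (auto simp: type_algebra_simps mult.commute)
qed

lemma genideal_type_algebra:
  "genideal (ring_of_type_algebra :: 'a::comm_ring_1 ring) G = ideal_span.span G"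
  unfolding genideal_def ideal_type_algebra_iff ideal_span.span_def hull_def by simp

text \<open>The quotient is a HOL-Algebra ring while computations use type-class polynomials; ideals
  are moved along the projection in both directions.\<close>

locale type_algebra_quotient =
  fixes I :: "'a::comm_ring_1 set"
  assumes subspace: "ideal_span.subspace I"
begin

abbreviation "Q \<equiv> (ring_of_type_algebra :: 'a ring) Quot I"

abbreviation "proj \<equiv> (+>\<^bsub>(ring_of_type_algebra :: 'a ring)\<^esub>) I"

sublocale base: cring "ring_of_type_algebra :: 'a ring"
  by (rule cring_from_type_algebra)

sublocale base_ideal: ideal I "ring_of_type_algebra :: 'a ring"
  using subspace by (simp add: ideal_type_algebra_iff)

sublocale quot: cring Q
  by (rule base_ideal.quotient_is_cring[OF base.is_cring])

sublocale proj: ring_hom_ring "ring_of_type_algebra :: 'a ring" Q proj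
  by (rule base_ideal.rcos_ring_hom_ring)

lemma proj_mult: "proj f \<otimes>\<^bsub>Q\<^esub> proj g = proj (f * g)"
  using proj.hom_mult[of f g] by (simp add: type_algebra_simps)

lemma proj_add: "proj f \<oplus>\<^bsub>Q\<^esub> proj g = proj (f + g)"
  using proj.hom_add[of f g] by (simp add: type_algebra_simps)

lemma proj_power: "proj f [^]\<^bsub>Q\<^esub> (n::nat) = proj (f ^ n)"
  using proj.hom_nat_pow[of f n] by (simp add: type_algebra_simps type_algebra_power)

lemma carrier_quot: "carrier Q = range proj"
  by (auto simp: FactRing_def A_RCOSETS_def' type_algebra_simps)

lemma proj_eqD: "proj f = proj g \<Longrightarrow> f - g \<in> I"
proof -
  assume "proj f = proj g"
  moreover have "f \<in> proj f"
    by (rule base_ideal.a_rcos_self) (simp add: type_algebra_simps)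
  ultimately obtain h where "h \<in> I" "f = h + g"
    unfolding a_r_coset_def' type_algebra_simps by blast
  then show "f - g \<in> I"
    by (simp only: add_diff_cancel)
qed

lemma proj_eq_0:
  assumes "f \<in> I"
  shows "proj f = \<zero>\<^bsub>Q\<^esub>"
  using base_ideal.a_rcos_const[OF assms] by (simp only: FactRing_def ring.simps)

lemma ideal_image_proj:
  assumes "ideal_span.subspace K"
  shows "ideal (proj ` K) Q"
proof -
  have inv: "\<ominus>\<^bsub>Q\<^esub> proj f = proj (- f)" for f
    using proj.hom_a_inv[of f] by (simp add: type_algebra_simps type_algebra_a_inv)
  have "subgroup (proj ` K) (add_monoid Q)"
  proof (rule quot.add.subgroupI)
    show "proj ` K \<subseteq> carrier Q" by (auto simp: carrier_quot)
    show "proj ` K \<noteq> {}" using ideal_span.subspace_0[OF assms] by auto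
    show "\<ominus>\<^bsub>Q\<^esub> a \<in> proj ` K" if "a \<in> proj ` K" for a
      using that ideal_span.subspace_neg[OF assms] by (auto simp: inv)
    show "a \<oplus>\<^bsub>Q\<^esub> b \<in> proj ` K" if "a \<in> proj ` K" "b \<in> proj ` K" for a b
      using that ideal_span.subspace_add[OF assms] by (auto simp: proj_add)
  qed
  moreover have "proj c \<otimes>\<^bsub>Q\<^esub> proj f \<in> proj ` K" "proj f \<otimes>\<^bsub>Q\<^esub> proj c \<in> proj ` K" if "f \<in> K" for c f
    using ideal_span.subspace_scale[OF assms that, of c]
    by (simp_all only: proj_mult mult.commute[of f c] imageI)
  ultimately show ?thesis
    by (intro idealI quot.ring_axioms) (unfold carrier_quot, blast+)
qed

lemma subspace_vimage_proj:
  assumes "ideal K Q"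
  shows "ideal_span.subspace (proj -` K)"
proof -
  interpret K: ideal K Q by fact
  show ?thesis
  proof (rule ideal_span.subspaceI)
    show "0 \<in> proj -` K"
      using K.zero_closed proj_eq_0[OF ideal_span.subspace_0[OF subspace]] by simp
    show "f + g \<in> proj -` K" if "f \<in> proj -` K" "g \<in> proj -` K" for f g
      using that K.a_closed[of "proj f" "proj g"] by (simp only: vimage_eq proj_add)
    show "c * f \<in> proj -` K" if "f \<in> proj -` K" for c f
      using that K.I_l_closed[of "proj f" "proj c"] by (simp only: vimage_eq proj_mult carrier_quot rangeI)
  qed
qed

end

section \<open>Powers of the maximal ideal\<close>

lemma degree_on_UNIV_eq_0_iff: "degree_on UNIV \<alpha> = 0 \<longleftrightarrow> \<alpha> = 0" for \<alpha> :: "'v::finite \<Rightarrow>\<^sub>0 nat"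
  by (auto simp: degree_on_def poly_mapping_eq_iff fun_eq_iff)

lemma order_ge_1: "order_ge UNIV 1 = {f. Poly_Mapping.lookup f (0 :: 'v::finite \<Rightarrow>\<^sub>0 nat) = 0}"
proof -
  have "1 \<le> degree_on UNIV \<alpha> \<longleftrightarrow> \<alpha> \<noteq> 0" for \<alpha> :: "'v \<Rightarrow>\<^sub>0 nat"
    using degree_on_UNIV_eq_0_iff[of \<alpha>] by linarith
  then show ?thesis
    by (auto simp: order_ge_def in_keys_iff)
qed

context
  fixes I :: "(('v::finite \<Rightarrow>\<^sub>0 nat) \<Rightarrow>\<^sub>0 'k::comm_ring_1) set"
  assumes subspace_I: "ideal_span.subspace I"
begin

interpretation quotient: type_algebra_quotient I
  by unfold_locales (fact subspace_I)

interpretation ideals: comm_monoid "ideals_set quotient.Q"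
  by (rule quotient.quot.ideals_set_is_comm_monoid)

text \<open>Orders add under multiplication, and an ideal product consists of sums of products.
  Degree bounds for monomials thus become containments of ideal powers.\<close>

lemma max_ideal_power_subset:
  "(quotient.proj ` order_ge UNIV 1) [^]\<^bsub>ideals_set quotient.Q\<^esub> d \<subseteq> quotient.proj ` order_ge UNIV d"
proof (induction d)
  case 0
  show ?case
    by (simp add: order_ge_0 quotient.carrier_quot ideals_set_def)
next
  case (Suc d)
  let ?M = "quotient.proj ` order_ge UNIV 1"
  have "x \<in> quotient.proj ` order_ge UNIV (Suc d)"
    if "x \<in> ideal_prod quotient.Q (?M [^]\<^bsub>ideals_set quotient.Q\<^esub> d) ?M" for x
    using that
  proof induction
    case (prod a b)
    with Suc.IH obtain f g where "f \<in> order_ge UNIV d" "g \<in> order_ge UNIV 1"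
      and ab: "a = quotient.proj f" "b = quotient.proj g" by blast
    then have "f * g \<in> order_ge UNIV (d + 1)" by (intro order_ge_mult)
    then show ?case
      unfolding ab quotient.proj_mult by simp
  next
    case (sum a b)
    then show ?case
      using ideal_span.subspace_add[OF subspace_order_ge]
      by (auto simp only: quotient.proj_add intro!: imageI)
  qed
  then show ?case
    unfolding ideals.nat_pow_Suc by (auto simp: ideals_set_def)
qed

text \<open>Variables are split off one at a time. This provides the witness for the lower
  bound.\<close>

lemma mon_in_max_ideal_power:
  "quotient.proj (mon \<alpha>) \<in>
    (quotient.proj ` order_ge UNIV 1) [^]\<^bsub>ideals_set quotient.Q\<^esub> degree_on UNIV \<alpha>"
proof (induction "degree_on UNIV \<alpha>" arbitrary: \<alpha>)
  case 0
  then show ?case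
    by (simp add: ideals_set_def quotient.carrier_quot flip: 0)
next
  case (Suc d)
  let ?M = "quotient.proj ` order_ge UNIV 1"
  have "\<alpha> \<noteq> 0"
    using Suc.hyps(2) degree_on_UNIV_eq_0_iff[of \<alpha>] by simp
  then obtain v where v: "0 < Poly_Mapping.lookup \<alpha> v"
    by (metis lookup_zero neq0_conv poly_mapping_eqI)
  define \<beta> where "\<beta> = \<alpha> - Poly_Mapping.single v 1"
  have \<alpha>: "\<alpha> = \<beta> + Poly_Mapping.single v 1"
    unfolding \<beta>_def using v by (intro poly_mapping_eqI) (auto simp: lookup_add lookup_minus lookup_single when_def)
  have "degree_on UNIV (Poly_Mapping.single v (1::nat)) = 1"
    by (simp add: degree_on_def lookup_single when_def)
  then have "d = degree_on UNIV \<beta>" "(var v :: _ \<Rightarrow>\<^sub>0 'k) \<in> order_ge UNIV 1"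
    using Suc.hyps(2) mon_in_order_ge[of "Poly_Mapping.single v 1" UNIV]
    by (simp_all add: \<alpha> degree_on_add var_def)
  then have "quotient.proj (mon \<beta>) \<otimes>\<^bsub>quotient.Q\<^esub> quotient.proj (var v) \<in>
      ideal_prod quotient.Q (?M [^]\<^bsub>ideals_set quotient.Q\<^esub> d) ?M"
    by (intro ideal_prod.prod) (use Suc.hyps(1) in auto)
  then have "quotient.proj (mon \<alpha>) \<in> ?M [^]\<^bsub>ideals_set quotient.Q\<^esub> Suc d"
    unfolding ideals.nat_pow_Suc quotient.proj_mult by (simp add: ideals_set_def \<alpha> var_def mon_add)
  then show ?case
    by (simp only: Suc.hyps(2))
qed

text \<open>The \<open>q\<close>-th power map is additive in characteristic p, so it acts term by
  term; a term of positive degree contains some variable, and its \<open>q\<close>-th power is a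
  multiple of \<open>var v ^ q\<close>.\<close>

lemma frobenius_power_subset:
  assumes "prime CHAR('k)" "q = CHAR('k) ^ s" "ideal_span.subspace J" "I \<subseteq> J" "\<And>v. var v ^ q \<in> J"
  shows "frobenius_power quotient.Q (quotient.proj ` order_ge UNIV 1) q \<subseteq> quotient.proj ` J"
  unfolding frobenius_power_def
proof (rule quotient.quot.genideal_minimal)
  show "ideal (quotient.proj ` J) quotient.Q"
    by (rule quotient.ideal_image_proj) fact
  have CHAR: "CHAR(('v \<Rightarrow>\<^sub>0 nat) \<Rightarrow>\<^sub>0 'k) = CHAR('k)"
  proof (rule CHAR_eqI)
    show "(of_nat CHAR('k) :: ('v \<Rightarrow>\<^sub>0 nat) \<Rightarrow>\<^sub>0 'k) = 0"
      by (metis of_nat_CHAR single_of_nat single_zero)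
    show "CHAR('k) dvd n" if "(of_nat n :: ('v \<Rightarrow>\<^sub>0 nat) \<Rightarrow>\<^sub>0 'k) = 0" for n
    proof -
      have "Poly_Mapping.lookup (of_nat n :: ('v \<Rightarrow>\<^sub>0 nat) \<Rightarrow>\<^sub>0 'k) 0 = 0"
        unfolding that by (rule lookup_zero)
      then show ?thesis
        by (simp add: lookup_of_nat of_nat_eq_0_iff_char_dvd)
    qed
  qed
  have "f ^ q \<in> J" if "f \<in> order_ge UNIV 1" for f :: "('v \<Rightarrow>\<^sub>0 nat) \<Rightarrow>\<^sub>0 'k"
  proof -
    have "f ^ q = (\<Sum>\<alpha>\<in>Poly_Mapping.keys f. Poly_Mapping.single \<alpha> (Poly_Mapping.lookup f \<alpha>)) ^ q"
      using poly_mapping_sum_single[of f] by (rule arg_cong)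
    also have "\<dots> = (\<Sum>\<alpha>\<in>Poly_Mapping.keys f. Poly_Mapping.single \<alpha> (Poly_Mapping.lookup f \<alpha>) ^ q)"
      using assms(1,2) CHAR by (intro freshmans_dream_sum') auto
    also have "\<dots> \<in> J"
    proof (rule ideal_span.subspace_sum[OF assms(3)])
      fix \<alpha> assume "\<alpha> \<in> Poly_Mapping.keys f"
      with that have "\<alpha> \<noteq> 0"
        using degree_on_UNIV_eq_0_iff[of \<alpha>] by (auto simp: order_ge_def)
      then obtain v where v: "0 < Poly_Mapping.lookup \<alpha> v"
        by (metis lookup_zero neq0_conv poly_mapping_eqI)
      have "Poly_Mapping.single \<alpha> (Poly_Mapping.lookup f \<alpha>) =
          Poly_Mapping.single 0 (Poly_Mapping.lookup f \<alpha>) * mon \<alpha>"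
        by (simp add: mult_single)
      also have "(mon \<alpha> :: _ \<Rightarrow>\<^sub>0 'k) = var v * mon (\<alpha> - Poly_Mapping.single v 1)"
        unfolding var_def using v by (intro mon_split) (auto simp: lookup_single when_def)
      finally have "Poly_Mapping.single \<alpha> (Poly_Mapping.lookup f \<alpha>) =
          (Poly_Mapping.single 0 (Poly_Mapping.lookup f \<alpha>) * mon (\<alpha> - Poly_Mapping.single v 1)) * var v"
        by (simp only: mult_ac)
      then have "(Poly_Mapping.single \<alpha> (Poly_Mapping.lookup f \<alpha>)) ^ q =
          (Poly_Mapping.single 0 (Poly_Mapping.lookup f \<alpha>) * mon (\<alpha> - Poly_Mapping.single v 1)) ^ q * var v ^ q"
        by (simp only: power_mult_distrib)
      then show "Poly_Mapping.single \<alpha> (Poly_Mapping.lookup f \<alpha>) ^ q \<in> J"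
        by (simp only: ideal_span.subspace_scale[OF assms(3,5)])
    qed
    finally show ?thesis .
  qed
  then show "{g [^]\<^bsub>quotient.Q\<^esub> q |g. g \<in> quotient.proj ` order_ge UNIV 1} \<subseteq> quotient.proj ` J"
    by (auto simp only: quotient.proj_power intro!: imageI)
qed

text \<open>Hence the preimage contains any ideal generated by elements of \<open>I\<close> and
  \<open>q\<close>-th powers of variables, such as \<open>minor_ideal\<close>.\<close>

lemma frobenius_power_vimage:
  shows "ideal_span.subspace (quotient.proj -` frobenius_power quotient.Q (quotient.proj ` order_ge UNIV 1) q)"
    and "I \<subseteq> quotient.proj -` frobenius_power quotient.Q (quotient.proj ` order_ge UNIV 1) q"
    and "var v ^ q \<in> quotient.proj -` frobenius_power quotient.Q (quotient.proj ` order_ge UNIV 1) q"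
proof -
  let ?M = "quotient.proj ` order_ge UNIV 1"
  let ?G = "{g [^]\<^bsub>quotient.Q\<^esub> q |g. g \<in> ?M}"
  have G: "?G \<subseteq> carrier quotient.Q"
  proof
    fix x assume "x \<in> ?G"
    then obtain f where "x = quotient.proj f [^]\<^bsub>quotient.Q\<^esub> q" by blast
    then show "x \<in> carrier quotient.Q"
      unfolding quotient.proj_power quotient.carrier_quot by (rule range_eqI)
  qed
  then have F: "ideal (frobenius_power quotient.Q ?M q) quotient.Q"
    unfolding frobenius_power_def by (rule quotient.quot.genideal_ideal)
  then show "ideal_span.subspace (quotient.proj -` frobenius_power quotient.Q ?M q)"
    by (rule quotient.subspace_vimage_proj)
  show "I \<subseteq> quotient.proj -` frobenius_power quotient.Q ?M q"
  proof
    fix f assume "f \<in> I"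
    then show "f \<in> quotient.proj -` frobenius_power quotient.Q ?M q"
      unfolding vimage_eq quotient.proj_eq_0[OF \<open>f \<in> I\<close>]
      by (intro additive_subgroup.zero_closed[OF ideal.axioms(1)[OF F]])
  qed
  have "(var v :: _ \<Rightarrow>\<^sub>0 'k) \<in> order_ge UNIV 1"
    using var_in_order_ge[of UNIV v, where 'b = 'k] by simp
  then have "quotient.proj (var v ^ q) \<in> ?G"
    unfolding quotient.proj_power[symmetric] by blast
  then show "var v ^ q \<in> quotient.proj -` frobenius_power quotient.Q ?M q"
    unfolding frobenius_power_def using quotient.quot.genideal_self[OF G] by blast
qed

end

section \<open>The determinantal ring\<close>

lemma det_generic_rows:
  "det (\<chi> i. generic_matrix $ \<rho> i) =
    (minor_on (\<lambda>i j. var (i, j)) \<rho> UNIV :: ('m::finite, 'n::finite, 'k::field) matrix_poly)"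
  by (simp add: det_def minor_on_def generic_matrix_def var_def)

lemma determinantal_ideal_eq:
  "(determinantal_ideal :: ('m::finite, 'n::finite, 'k::field) matrix_poly set) =
    ideal_span.span {minor_on (\<lambda>i j. var (i, j)) \<rho> UNIV | \<rho>. inj \<rho>}"
  by (simp add: determinantal_ideal_def genideal_type_algebra maximal_minors_def det_generic_rows)

lemma subspace_determinantal_ideal:
  "ideal_span.subspace (determinantal_ideal :: ('m::finite, 'n::finite, 'k::field) matrix_poly set)"
  by (simp add: determinantal_ideal_eq)

lemma determinantal_max_ideal_eq:
  "(determinantal_max_ideal :: ('m::finite, 'n::finite, 'k::field) matrix_poly set set) =
    (+>\<^bsub>matrix_poly_ring\<^esub>) determinantal_ideal ` order_ge UNIV 1"
  by (simp only: determinantal_max_ideal_def order_ge_1)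

text \<open>The monomial ideal generated by all \<open>q\<close>-th powers of variables and by the
  variables of column \<open>b\<close>, encoded so that membership is read off from the
  support.\<close>

definition column_monomial_ideal :: "nat \<Rightarrow> 'n \<Rightarrow> (('m \<times> 'n \<Rightarrow>\<^sub>0 nat) \<Rightarrow>\<^sub>0 'k::comm_ring_1) set"
  where "column_monomial_ideal q b = {f. \<forall>\<alpha>\<in>Poly_Mapping.keys f.
    (\<exists>v. q \<le> Poly_Mapping.lookup \<alpha> v) \<or> (\<exists>i. 0 < Poly_Mapping.lookup \<alpha> (i, b))}"

lemma subspace_column_monomial_ideal: "ideal_span.subspace (column_monomial_ideal q b)"
proof (rule ideal_span.subspaceI)
  show "0 \<in> column_monomial_ideal q b"
    by (simp add: column_monomial_ideal_def)
  show "f + g \<in> column_monomial_ideal q b"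
    if "f \<in> column_monomial_ideal q b" "g \<in> column_monomial_ideal q b" for f g
    using that keys_add[of f g] by (auto simp: column_monomial_ideal_def)
  show "c * f \<in> column_monomial_ideal q b" if "f \<in> column_monomial_ideal q b" for c f
    unfolding column_monomial_ideal_def
  proof (intro CollectI ballI)
    fix \<alpha> assume "\<alpha> \<in> Poly_Mapping.keys (c * f)"
    then obtain \<beta> \<gamma> where "\<gamma> \<in> Poly_Mapping.keys f" and \<alpha>: "\<alpha> = \<beta> + \<gamma>"
      using keys_mult[of c f] by blast
    with that have "(\<exists>v. q \<le> Poly_Mapping.lookup \<gamma> v) \<or> (\<exists>i. 0 < Poly_Mapping.lookup \<gamma> (i, b))"
      by (auto simp: column_monomial_ideal_def)
    then show "(\<exists>v. q \<le> Poly_Mapping.lookup \<alpha> v) \<or> (\<exists>i. 0 < Poly_Mapping.lookup \<alpha> (i, b))"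
      unfolding \<alpha> lookup_add by (meson add_pos_nonneg le_add2 order_trans trans_less_add2)
  qed
qed

lemma var_power_in_column_monomial_ideal: "var v ^ q \<in> column_monomial_ideal q b"
proof -
  have "\<exists>w. q \<le> Poly_Mapping.lookup (Poly_Mapping.single v q) w"
    by (rule exI[of _ v]) simp
  then show ?thesis
    unfolding var_power column_monomial_ideal_def by simp
qed

text \<open>Every term of a maximal minor has one factor from column \<open>b\<close>.\<close>

lemma minor_in_column_monomial_ideal:
  fixes b :: "'n::finite" and \<rho> :: "'n \<Rightarrow> 'm"
  shows "(minor_on (\<lambda>i j. var (i, j)) \<rho> UNIV :: _ \<Rightarrow>\<^sub>0 'k::comm_ring_1) \<in> column_monomial_ideal q b"
  unfolding minor_on_def
proof (intro ideal_span.subspace_sum ideal_span.subspace_scale subspace_column_monomial_ideal)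
  fix \<pi> :: "'n \<Rightarrow> 'n" assume "\<pi> \<in> {\<pi>. \<pi> permutes UNIV}"
  then obtain l where l: "\<pi> l = b"
    by (metis mem_Collect_eq permutes_surj surjD)
  have "\<exists>i. 0 < Poly_Mapping.lookup (Poly_Mapping.single (\<rho> l, b) (1::nat)) (i, b)"
    by (rule exI[of _ "\<rho> l"]) simp
  then have "(var (\<rho> l, b) :: _ \<Rightarrow>\<^sub>0 'k) \<in> column_monomial_ideal q b"
    unfolding var_def column_monomial_ideal_def by simp
  then have "(\<Prod>j\<in>UNIV - {l}. var (\<rho> j, \<pi> j)) * (var (\<rho> l, b) :: _ \<Rightarrow>\<^sub>0 'k) \<in> column_monomial_ideal q b"
    by (rule ideal_span.subspace_scale[OF subspace_column_monomial_ideal])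
  then show "(\<Prod>j\<in>UNIV. var (\<rho> j, \<pi> j) :: _ \<Rightarrow>\<^sub>0 'k) \<in> column_monomial_ideal q b"
    by (simp add: prod.remove[of UNIV l] l mult.commute)
qed

lemma frobenius_top_degree_determinantal:
  assumes p: "prime CHAR('k::field)" "q = CHAR('k) ^ s"
    and card: "CARD('n::finite) \<le> CARD('m::finite)"
  shows "frobenius_top_degree (determinantal_ring :: ('m, 'n, 'k) matrix_poly set ring)
    determinantal_max_ideal q = CARD('m) * (CARD('n) - 1) * (q - 1)"
proof -
  let ?I = "determinantal_ideal :: ('m, 'n, 'k) matrix_poly set"
  let ?Q = "determinantal_ring :: ('m, 'n, 'k) matrix_poly set ring"
  let ?M = "determinantal_max_ideal :: ('m, 'n, 'k) matrix_poly set set"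
  let ?F = "frobenius_power ?Q ?M q"
  let ?N = "CARD('m) * (CARD('n) - 1) * (q - 1)"
  interpret quotient: type_algebra_quotient ?I
    by unfold_locales (rule subspace_determinantal_ideal)
  note M = determinantal_max_ideal_eq[where 'm = 'm and 'n = 'n and 'k = 'k]
  note Q = determinantal_ring_def[where 'm = 'm and 'n = 'n and 'k = 'k]
  note I = subspace_determinantal_ideal[where 'm = 'm and 'n = 'n and 'k = 'k]

  \<comment> \<open>Upper bound for the top degree\<close>
  have upper: "?M [^]\<^bsub>ideals_set ?Q\<^esub> d \<subseteq> ?F" if "?N < d" for d
  proof -
    have "minor_ideal q UNIV UNIV \<subseteq> quotient.proj -` ?F"
    proof (rule minor_ideal_subset)
      fix \<rho> :: "'n \<Rightarrow> 'm" assume "inj \<rho>"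
      then have "minor_on (\<lambda>i j. var (i, j)) \<rho> UNIV \<in> ?I"
        unfolding determinantal_ideal_eq by (intro ideal_span.span_base) auto
      then show "minor_on (\<lambda>i j. var (i, j)) \<rho> UNIV \<in> quotient.proj -` ?F"
        using frobenius_power_vimage(2)[OF I, of q] unfolding M Q by blast
    qed (unfold M Q, (rule frobenius_power_vimage(1,3)[OF I])+)
    moreover have "(order_ge UNIV d :: ('m, 'n, 'k) matrix_poly set) \<subseteq> minor_ideal q UNIV UNIV"
    proof (rule order_ge_subset_ideal[OF subspace_minor_ideal])
      fix \<alpha> :: "'m \<times> 'n \<Rightarrow>\<^sub>0 nat" assume "d \<le> degree_on UNIV \<alpha>"
      with that show "(mon \<alpha> :: ('m, 'n, 'k) matrix_poly) \<in> minor_ideal q UNIV UNIV"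
        by (intro mon_in_minor_ideal[OF p]) (use card in auto)
    qed
    ultimately show ?thesis
      using max_ideal_power_subset[OF I, of d] unfolding M Q by blast
  qed

  \<comment> \<open>Lower bound for the top degree\<close>
  obtain b :: 'n where True by blast
  define \<alpha> :: "'m \<times> 'n \<Rightarrow>\<^sub>0 nat"
    where "\<alpha> = Abs_poly_mapping (\<lambda>(i, j). if j = b then 0 else q - 1)"
  have \<alpha>: "Poly_Mapping.lookup \<alpha> (i, j) = (if j = b then 0 else q - 1)" for i j
    by (simp add: \<alpha>_def lookup_Abs_poly_mapping)
  have degree: "degree_on UNIV \<alpha> = ?N"
  proof -
    have "degree_on UNIV \<alpha> = (\<Sum>(i, j)\<in>UNIV \<times> UNIV. Poly_Mapping.lookup \<alpha> (i, j))"
      by (simp add: degree_on_def)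
    also have "\<dots> = (\<Sum>i\<in>(UNIV :: 'm set). \<Sum>j\<in>UNIV. if j = b then 0 else q - 1)"
      by (simp only: sum.cartesian_product[symmetric] \<alpha>)
    also have "(\<Sum>j\<in>UNIV. if j = b then 0 else q - 1) = (\<Sum>j\<in>UNIV - {b}. q - 1)"
      by (rule sum.mono_neutral_cong_right) auto
    finally show ?thesis by (simp add: mult.assoc)
  qed
  have lower: "\<not> ?M [^]\<^bsub>ideals_set ?Q\<^esub> ?N \<subseteq> ?F"
  proof
    let ?J = "column_monomial_ideal q b :: ('m, 'n, 'k) matrix_poly set"
    assume "?M [^]\<^bsub>ideals_set ?Q\<^esub> ?N \<subseteq> ?F"
    then have "quotient.proj (mon \<alpha>) \<in> ?F"
      using mon_in_max_ideal_power[OF I, of \<alpha>] unfolding M Q degree by blast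
    moreover have "?I \<subseteq> ?J"
      unfolding determinantal_ideal_eq
      using minor_in_column_monomial_ideal[of _ q b]
      by (intro ideal_span.span_minimal subspace_column_monomial_ideal) auto
    ultimately have "quotient.proj (mon \<alpha>) \<in> quotient.proj ` ?J"
      using frobenius_power_subset[OF I p subspace_column_monomial_ideal _ var_power_in_column_monomial_ideal]
      unfolding M Q by blast
    then obtain f where "f \<in> ?J" "quotient.proj (mon \<alpha>) = quotient.proj f"
      by blast
    \<comment> \<open>As \<open>?J\<close> contains the kernel \<open>?I\<close>, membership in its
      image lifts back to \<open>mon \<alpha>\<close>.\<close>
    with \<open>?I \<subseteq> ?J\<close> have "mon \<alpha> - f \<in> ?J"
      using quotient.proj_eqD by blast
    then have "(mon \<alpha> - f) + f \<in> ?J"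
      using \<open>f \<in> ?J\<close> by (rule ideal_span.subspace_add[OF subspace_column_monomial_ideal])
    then have "(\<exists>v. q \<le> Poly_Mapping.lookup \<alpha> v) \<or> (\<exists>i. 0 < Poly_Mapping.lookup \<alpha> (i, b))"
      by (simp add: column_monomial_ideal_def)
    moreover have "0 < q" using p by (simp add: prime_gt_0_nat)
    ultimately show False
      by (auto simp: \<alpha> split: if_splits)
  qed
  have "?N \<in> {d. \<not> ?M [^]\<^bsub>ideals_set ?Q\<^esub> d \<subseteq> ?F}"
    using lower by simp
  moreover have le: "d \<le> ?N" if "d \<in> {d. \<not> ?M [^]\<^bsub>ideals_set ?Q\<^esub> d \<subseteq> ?F}" for d
    using that upper[of d] not_le by blast
  \<comment> \<open>\<open>Max\<close> is meaningful only on a finite nonempty set.\<close>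
  moreover have "finite {d :: nat. \<not> ?M [^]\<^bsub>ideals_set ?Q\<^esub> d \<subseteq> ?F}"
    unfolding finite_nat_set_iff_bounded_le using le by blast
  ultimately show ?thesis
    unfolding frobenius_top_degree_def by (intro Max_eqI)
qed

theorem theorem4p1:
  fixes p :: nat
    and R :: "('m::finite, 'n::finite, 'k::field) matrix_poly set ring"
    and \<mm> :: "('m, 'n, 'k) matrix_poly set set"
  assumes "CHAR('k) = p" and "p > 0"
    and "CARD('m) \<ge> CARD('n)"
  defines "R \<equiv> determinantal_ring" and "\<mm> \<equiv> determinantal_max_ideal"
  shows "convergent (F_threshold_seq p R \<mm>) \<and>
    diagonal_F_threshold p R \<mm> = real CARD('m) * (real CARD('n) - 1)"
proof -
  let ?c = "real CARD('m) * (real CARD('n) - 1)"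
  have p: "prime p"
    using assms(1,2) prime_CHAR_semidom[where 'a = 'k] by simp
  \<comment> \<open>Dividing the top degree at \<open>q = p ^ s\<close> by \<open>q\<close> leaves
    the limit times \<open>1 - 1 / q\<close>.\<close>
  have "F_threshold_seq p R \<mm> = (\<lambda>s. ?c * (1 - inverse (real p ^ s)))"
  proof
    fix s
    have "frobenius_top_degree R \<mm> (p ^ s) = CARD('m) * (CARD('n) - 1) * (p ^ s - 1)"
      unfolding R_def \<mm>_def
      by (rule frobenius_top_degree_determinantal) (use p assms(1,3) in auto)
    moreover have "real (p ^ s - 1) = real p ^ s - 1" "real (CARD('n) - 1) = real CARD('n) - 1"
      using assms(2) by (simp_all add: of_nat_diff Suc_le_eq)
    ultimately show "F_threshold_seq p R \<mm> s = ?c * (1 - inverse (real p ^ s))"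
      using assms(2) by (simp add: F_threshold_seq_def field_simps)
  qed
  moreover have "(\<lambda>s. ?c * (1 - inverse (real p ^ s))) \<longlonglongrightarrow> ?c * (1 - 0)"
    using prime_gt_1_nat[OF p] by (intro tendsto_intros LIMSEQ_inverse_realpow_zero) simp
  ultimately have "F_threshold_seq p R \<mm> \<longlonglongrightarrow> ?c"
    by simp
  then show ?thesis
    unfolding diagonal_F_threshold_def by (auto intro: convergentI limI)
qed

end
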